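(* Let $(X,\mu)$ be a computable probability space, $n\ge 1$, and $x\in X$ be weakly $(n+1)$-random. Then for any $\Pi^0_n$ set $A\ni x$ with $\mu(A)>0$ and any computable measure-preserving transformation $T:\subseteq X\to X$ with $x\in\operatorname{dom}T$, the following limit exists and satisfies $$\lim_{N\to\infty}\frac1N\sum_{k<N}\mathbf 1_A\bigl(T^k(x)\bigr)>0.$$
   Context: Uniformity: a sequence of objects has a property (whose definition involves an index in $\mathbb N$) uniformly if a computable function produces suitable indices. $\mathbf 1_A$ is the characteristic function of $A$. A computable metric space is a triple $(X,d,S)$ where $(X,d)$ is a complete separable metric space, $S=(s_i)_i$ is a dense sequence in $X$, and $d(s_i,s_j)$ is a computable real number uniformly in $i,j$. With $(q_j)_j$ a fixed enumeration of the positive rationals and $\langle\cdot,\cdot\rangle$ the standard pairing function, the ideal balls are $B_{\langle i,j\rangle}=\{x\in X: d(x,s_i)<q_j\}$. A set $U\subseteq X$ is $\Sigma^0_1$ if $U=\bigcup_{i\in W}B_i$ for some c.e. $W\subseteq\mathbb N$ (its index is an index of $W$). A set is $\Pi^0_n$ if its complement is $\Sigma^0_n$. A set is $\Sigma^0_{n+1}$ if it equals $\bigcup_{i\in W}(X\setminus U^n_i)$ for some c.e. $W\subseteq\mathbb N$, where $U^n_i$ is the $i$-th $\Sigma^0_n$ set. For $D\subseteq X$, a subset of $D$ is $\Sigma^0_n$ in $D$ if it is the intersection of $D$ with a $\Sigma^0_n$ subset of $X$. A computable probability space $(X,\mu)$ is a computable metric space with a Borel probability measure $\mu$ such that $\mu(\bigcup_{i\in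 F}B_i)$ is lower-semicomputable uniformly in finite $F\subseteq\mathbb N$. A point is weakly $m$-random if it lies in no $\mu$-null $\Pi^0_m$ set. A measure-preserving transformation is a partial Borel measurable map $T:\subseteq X\to X$ such that $\mu(T^{-1}(B))=\mu(B)$ for every Borel $B$ (so $\operatorname{dom}T$ has full measure) and $x\in\operatorname{dom}T$ implies $T(x)\in\operatorname{dom}T$. It is computable if the sets $T^{-1}(B_i)$ are uniformly $\Sigma^0_1$ in $\operatorname{dom}T$. *)

theory Defs
  imports "HOL-Library.Nat_Bijection" "HOL-Probability.Probability"
begin

text \<open>Programs for the partial recursive functions of one argument. Functions of several arguments
  are functions of one argument through the pairing function \<^const>\<open>prod_encode\<close>.\<close>

datatype prog =
    Zero | Succ | ProjL | ProjR
  | Pairing prog prog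
  | Compose prog prog
  | PrimRec prog prog
  | Minimize prog

primrec run :: "prog \<Rightarrow> nat \<Rightarrow> nat option" where
  "run Zero x = Some 0"
| "run Succ x = Some (Suc x)"
| "run ProjL x = Some (fst (prod_decode x))"
| "run ProjR x = Some (snd (prod_decode x))"
| "run (Pairing f g) x =
     Option.bind (run f x) (\<lambda>a. Option.bind (run g x) (\<lambda>b. Some (prod_encode (a, b))))"
| "run (Compose f g) x = Option.bind (run g x) (run f)"
| "run (PrimRec f g) x =
     (let (a, n) = prod_decode x
      in rec_nat (run f a)
           (\<lambda>m r. Option.bind r (\<lambda>y. run g (prod_encode (a, prod_encode (m, y))))) n)"
| "run (Minimize f) x =
     (if \<exists>n. run f (prod_encode (x, n)) = Some 0 \<and>
             (\<forall>m<n. \<exists>y. run f (prod_encode (x, m)) = Some (Suc y))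
      then Some (LEAST n. run f (prod_encode (x, n)) = Some 0)
      else None)"

primrec godel :: "prog \<Rightarrow> nat" where
  "godel Zero = prod_encode (0, 0)"
| "godel Succ = prod_encode (1, 0)"
| "godel ProjL = prod_encode (2, 0)"
| "godel ProjR = prod_encode (3, 0)"
| "godel (Pairing f g) = prod_encode (4, prod_encode (godel f, godel g))"
| "godel (Compose f g) = prod_encode (5, prod_encode (godel f, godel g))"
| "godel (PrimRec f g) = prod_encode (6, prod_encode (godel f, godel g))"
| "godel (Minimize f) = prod_encode (7, godel f)"

lemma inj_godel: "inj godel"
proof (rule injI)
  fix p q show "godel p = godel q \<Longrightarrow> p = q"
  proof (induction p arbitrary: q)
    case Zero then show ?case by (cases q) (auto simp: prod_encode_eq)
  next
    case Succ then show ?case by (cases q) (auto simp: prod_encode_eq)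
  next
    case ProjL then show ?case by (cases q) (auto simp: prod_encode_eq)
  next
    case ProjR then show ?case by (cases q) (auto simp: prod_encode_eq)
  next
    case (Pairing p1 p2) then show ?case by (cases q) (auto simp: prod_encode_eq)
  next
    case (Compose p1 p2) then show ?case by (cases q) (auto simp: prod_encode_eq)
  next
    case (PrimRec p1 p2) then show ?case by (cases q) (auto simp: prod_encode_eq)
  next
    case (Minimize p) then show ?case by (cases q) (auto simp: prod_encode_eq)
  qed
qed

text \<open>\<open>phi e x y\<close>: the \<open>e\<close>-th partial recursive function is defined at \<open>x\<close> with value \<open>y\<close>.
  A number that is not the code of a program is an index of the nowhere defined function.\<close>

definition phi :: "nat \<Rightarrow> nat \<Rightarrow> nat \<Rightarrow> bool" where
  "phi e x y \<longleftrightarrow> (\<exists>p. godel p = e \<and> run p x = Some y)"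

definition W :: "nat \<Rightarrow> nat set" where
  "W e = {x. \<exists>y. phi e x y}"

definition computable :: "(nat \<Rightarrow> nat) \<Rightarrow> bool" where
  "computable f \<longleftrightarrow> (\<exists>e. \<forall>x. phi e x (f x))"

text \<open>Here \<open>P i e\<close> is to be read: \<open>e\<close> is an index witnessing the property for the \<open>i\<close>-th object.\<close>

definition uniformly :: "(nat \<Rightarrow> nat \<Rightarrow> bool) \<Rightarrow> bool" where
  "uniformly P \<longleftrightarrow> (\<exists>f. computable f \<and> (\<forall>i. P i (f i)))"

definition rat_enum :: "nat \<Rightarrow> rat" where
  "rat_enum n = (let (a, b) = prod_decode n in of_int (int_decode a) / of_nat (Suc b))"

definition pos_rat_enum :: "nat \<Rightarrow> rat" where
  "pos_rat_enum n = (let (a, b) = prod_decode n in of_nat (Suc a) / of_nat (Suc b))"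

definition computable_real_index :: "nat \<Rightarrow> real \<Rightarrow> bool" where
  "computable_real_index e r \<longleftrightarrow>
     (\<forall>k. \<exists>m. phi e k m \<and> \<bar>r - of_rat (rat_enum m)\<bar> \<le> 1 / 2 ^ k)"

definition lower_semicomputable_index :: "nat \<Rightarrow> real \<Rightarrow> bool" where
  "lower_semicomputable_index e r \<longleftrightarrow> W e = {m. of_rat (rat_enum m) < r}"

text \<open>The complete separable metric space is the type \<^typ>\<open>'a\<close> with its metric \<^const>\<open>dist\<close>.\<close>

definition computable_metric_space :: "(nat \<Rightarrow> 'a::polish_space) \<Rightarrow> bool" where
  "computable_metric_space s \<longleftrightarrow>
     closure (range s) = UNIV \<and>
     uniformly (\<lambda>n e. let (i, j) = prod_decode n in computable_real_index e (dist (s i) (s j)))"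

definition ideal_ball :: "(nat \<Rightarrow> 'a::metric_space) \<Rightarrow> nat \<Rightarrow> 'a set" where
  "ideal_ball s n = (let (i, j) = prod_decode n in {x. dist x (s i) < of_rat (pos_rat_enum j)})"

text \<open>\<open>sigma_set s n e\<close> is the \<open>e\<close>-th \<open>\<Sigma>\<^sup>0\<^sub>n\<close> set. The hierarchy starts at \<open>n = 1\<close>; the value at
  \<open>n = 0\<close> is a dummy.\<close>

fun sigma_set :: "(nat \<Rightarrow> 'a::metric_space) \<Rightarrow> nat \<Rightarrow> nat \<Rightarrow> 'a set" where
  "sigma_set s 0 e = {}"
| "sigma_set s (Suc 0) e = (\<Union>i\<in>W e. ideal_ball s i)"
| "sigma_set s (Suc (Suc n)) e = (\<Union>i\<in>W e. - sigma_set s (Suc n) i)"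

definition is_Sigma :: "(nat \<Rightarrow> 'a::metric_space) \<Rightarrow> nat \<Rightarrow> 'a set \<Rightarrow> bool" where
  "is_Sigma s n A \<longleftrightarrow> n \<ge> 1 \<and> (\<exists>e. A = sigma_set s n e)"

definition is_Pi :: "(nat \<Rightarrow> 'a::metric_space) \<Rightarrow> nat \<Rightarrow> 'a set \<Rightarrow> bool" where
  "is_Pi s n A \<longleftrightarrow> is_Sigma s n (- A)"

definition Sigma_in_index ::
  "(nat \<Rightarrow> 'a::metric_space) \<Rightarrow> nat \<Rightarrow> 'a set \<Rightarrow> nat \<Rightarrow> 'a set \<Rightarrow> bool" where
  "Sigma_in_index s n D e A \<longleftrightarrow> A = D \<inter> sigma_set s n e"

text \<open>Finite sets of naturals are given by their canonical indices, see \<^const>\<open>set_decode\<close>.\<close>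

definition computable_prob_space :: "(nat \<Rightarrow> 'a::polish_space) \<Rightarrow> 'a measure \<Rightarrow> bool" where
  "computable_prob_space s M \<longleftrightarrow>
     computable_metric_space s \<and> prob_space M \<and> sets M = sets borel \<and>
     uniformly (\<lambda>n e. lower_semicomputable_index e
       (measure M (\<Union>i\<in>set_decode n. ideal_ball s i)))"

definition weakly_random ::
  "(nat \<Rightarrow> 'a::polish_space) \<Rightarrow> 'a measure \<Rightarrow> nat \<Rightarrow> 'a \<Rightarrow> bool" where
  "weakly_random s M m x \<longleftrightarrow> (\<forall>A. is_Pi s m A \<and> A \<in> null_sets M \<longrightarrow> x \<notin> A)"

text \<open>The preimage of \<open>B\<close> under a partial map \<open>T\<close> is \<open>T -` (Some ` B)\<close>. Applied to
  \<open>B = UNIV\<close>, the first condition below makes \<open>dom T\<close> a Borel set.\<close>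

definition measure_preserving :: "'a::polish_space measure \<Rightarrow> ('a \<rightharpoonup> 'a) \<Rightarrow> bool" where
  "measure_preserving M T \<longleftrightarrow>
     (\<forall>B\<in>sets borel. T -` (Some ` B) \<in> sets borel) \<and>
     (\<forall>B\<in>sets borel. emeasure M (T -` (Some ` B)) = emeasure M B) \<and>
     (\<forall>x\<in>dom T. the (T x) \<in> dom T)"

definition computable_map :: "(nat \<Rightarrow> 'a::polish_space) \<Rightarrow> ('a \<rightharpoonup> 'a) \<Rightarrow> bool" where
  "computable_map s T \<longleftrightarrow>
     uniformly (\<lambda>i e. Sigma_in_index s 1 (dom T) e (T -` (Some ` ideal_ball s i)))"

end

theory Submission
  imports Defs
begin

text \<open>Let \<open>U\<close> be the complement of \<open>A\<close>. Since \<open>\<Pi>\<^sup>0\<^sub>n \<subseteq> \<Pi>\<^sup>0\<^sub>n\<^sub>+\<^sub>1\<close>, the set \<open>A\<close> is the intersection of a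
  decreasing uniform sequence of \<open>\<Sigma>\<^sup>0\<^sub>n\<close> sets \<open>V\<^sub>i\<close>. By the maximal inequality, the points at which for
  every \<open>i\<close> some Birkhoff average of \<open>V\<^sub>i \<inter> U\<close> exceeds \<open>\<epsilon>\<close> form a null \<open>\<Pi>\<^sup>0\<^sub>n\<^sub>+\<^sub>1\<close> set, so for some \<open>i\<close> all
  averages of \<open>V\<^sub>i \<inter> U\<close> along the orbit of \<open>x\<close> are at most \<open>\<epsilon>\<close>. If the averages of \<open>U\<close> along that orbit
  oscillated between \<open>a\<close> and \<open>b > a + \<epsilon>\<close>, then infinitely often the averages of \<open>U\<close> would be above \<open>b\<close>
  and those of \<open>V\<^sub>i\<close> above \<open>1 - a\<close>. Both conditions are \<open>\<Pi>\<^sup>0\<^sub>n\<^sub>+\<^sub>1\<close>, and together with the bound \<open>\<epsilon>\<close> they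
  define a subset of the null set of points with oscillating averages. Likewise, the points of \<open>A\<close>
  whose averages for \<open>A\<close> have lower limit \<open>0\<close> form a null \<open>\<Pi>\<^sup>0\<^sub>n\<^sub>+\<^sub>1\<close> set, so the limit at \<open>x\<close> is positive.\<close>

section \<open>Computable functions and recursively enumerable predicates\<close>

abbreviation pair :: "nat \<Rightarrow> nat \<Rightarrow> nat" where "pair a b \<equiv> prod_encode (a, b)"
abbreviation left :: "nat \<Rightarrow> nat" where "left z \<equiv> fst (prod_decode z)"
abbreviation right :: "nat \<Rightarrow> nat" where "right z \<equiv> snd (prod_decode z)"

lemma computable_iff: "computable f \<longleftrightarrow> (\<exists>p. \<forall>x. run p x = Some (f x))"
  unfolding computable_def phi_def by (metis inj_godel injD)

lemma computable_id: "computable (\<lambda>x. x)"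
proof -
  have "run (Pairing ProjL ProjR) x = Some x" for x by simp
  then show ?thesis unfolding computable_iff by blast
qed

lemma computable_comp: "computable f \<Longrightarrow> computable g \<Longrightarrow> computable (\<lambda>x. f (g x))"
proof -
  assume "computable f" "computable g"
  then obtain p q where "\<And>x. run p x = Some (f x)" "\<And>x. run q x = Some (g x)"
    unfolding computable_iff by blast
  then have "run (Compose p q) x = Some (f (g x))" for x by simp
  then show ?thesis unfolding computable_iff by blast
qed

lemma computable_Suc: "computable f \<Longrightarrow> computable (\<lambda>x. Suc (f x))"
  by (rule computable_comp[of Suc]) (auto simp: computable_iff intro!: exI[of _ Succ])

lemma computable_left: "computable f \<Longrightarrow> computable (\<lambda>x. left (f x))"
  by (rule computable_comp[of left]) (auto simp: computable_iff intro!: exI[of _ ProjL])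

lemma computable_right: "computable f \<Longrightarrow> computable (\<lambda>x. right (f x))"
  by (rule computable_comp[of right]) (auto simp: computable_iff intro!: exI[of _ ProjR])

lemma computable_pair: "computable f \<Longrightarrow> computable g \<Longrightarrow> computable (\<lambda>x. pair (f x) (g x))"
proof -
  assume "computable f" "computable g"
  then obtain p q where "\<And>x. run p x = Some (f x)" "\<And>x. run q x = Some (g x)"
    unfolding computable_iff by blast
  then have "run (Pairing p q) x = Some (pair (f x) (g x))" for x by simp
  then show ?thesis unfolding computable_iff by blast
qed

lemma computable_const: "computable (\<lambda>x. c)"
proof (induction c)
  case 0 show ?case by (auto simp: computable_iff intro!: exI[of _ Zero])
qed (rule computable_Suc)

text \<open>\<open>PrimRec\<close> carries a parameter unchanged and recurses on the second
  component of its argument. Composing with the pair of \<open>x\<close> and \<open>h x\<close> lets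
  start value, step and length all depend on \<open>x\<close>; the nested projections in the last
  hypothesis match the tuple that \<open>PrimRec\<close> hands to its step program.\<close>

lemma computable_rec:
  assumes "computable f" "computable h"
    and "computable (\<lambda>z. g (left z) (left (right z)) (right (right z)))"
  shows "computable (\<lambda>x. rec_nat (f x) (g x) (h x))"
proof -
  from assms(1,3) obtain p q where pq: "\<And>x. run p x = Some (f x)"
      "\<And>z. run q z = Some (g (left z) (left (right z)) (right (right z)))"
    unfolding computable_iff by blast
  have "run (PrimRec p q) (pair x n) = Some (rec_nat (f x) (g x) n)" for x n
    by (induction n) (auto simp: pq)
  then have "run (PrimRec p q) z = Some (rec_nat (f (left z)) (g (left z)) (right z))" for z
    by (metis prod.collapse prod_decode_inverse)
  then have "computable (\<lambda>z. rec_nat (f (left z)) (g (left z)) (right z))"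
    unfolding computable_iff by blast
  from computable_comp[OF this computable_pair[OF computable_id assms(2)]] show ?thesis by simp
qed

lemmas computable_basic = computable_id computable_Suc computable_left computable_right
  computable_pair computable_const

lemma computable_add:
  assumes "computable f" "computable g" shows "computable (\<lambda>x. f x + g x)"
proof -
  have "rec_nat a (\<lambda>_ y. Suc y) b = a + b" for a b by (induction b) auto
  moreover have "computable (\<lambda>x. rec_nat (f x) (\<lambda>_ y. Suc y) (g x))"
    using assms by (intro computable_rec computable_basic)
  ultimately show ?thesis by simp
qed

lemma computable_mult:
  assumes "computable f" "computable g" shows "computable (\<lambda>x. f x * g x)"
proof -
  have "rec_nat 0 (\<lambda>_ y. y + a) b = a * b" for a b :: nat by (induction b) auto
  moreover have "computable (\<lambda>x. rec_nat 0 (\<lambda>_ y. y + f x) (g x))"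
    by (intro computable_rec computable_basic computable_add computable_comp[OF assms(1)] assms)
  ultimately show ?thesis by simp
qed

lemma computable_power2:
  assumes "computable f" shows "computable (\<lambda>x. 2 ^ f x)"
proof -
  have "rec_nat 1 (\<lambda>_ y. y + y) b = (2::nat) ^ b" for b by (induction b) auto
  moreover have "computable (\<lambda>x. rec_nat 1 (\<lambda>_ y. y + y) (f x))"
    by (intro computable_rec computable_basic computable_add assms)
  ultimately show ?thesis by simp
qed

lemma computable_diff:
  assumes "computable f" "computable g" shows "computable (\<lambda>x. f x - g x)"
proof -
  have pred: "computable (\<lambda>x. h x - 1)" if "computable h" for h
  proof -
    have "rec_nat 0 (\<lambda>m _. m) b = b - 1" for b by (cases b) auto
    moreover have "computable (\<lambda>x. rec_nat 0 (\<lambda>m _. m) (h x))"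
      by (intro computable_rec computable_basic that)
    ultimately show ?thesis by simp
  qed
  have "rec_nat a (\<lambda>_ y. y - 1) b = a - b" for a b :: nat by (induction b) auto
  moreover have "computable (\<lambda>x. rec_nat (f x) (\<lambda>_ y. y - 1) (g x))"
    by (intro computable_rec computable_basic pred assms)
  ultimately show ?thesis by simp
qed

section \<open>Decidable predicates\<close>

definition decidable :: "(nat \<Rightarrow> bool) \<Rightarrow> bool" where
  "decidable P \<longleftrightarrow> computable (\<lambda>x. of_bool (P x))"

lemma computable_if:
  assumes "decidable P" "computable f" "computable g"
  shows "computable (\<lambda>x. if P x then f x else g x)"
proof -
  have "computable (\<lambda>x. of_bool (P x) * f x + (1 - of_bool (P x)) * g x)"
    using assms unfolding decidable_def
    by (intro computable_add computable_mult computable_diff computable_const)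
  moreover have "of_bool (P x) * f x + (1 - of_bool (P x)) * g x = (if P x then f x else g x)" for x
    by simp
  ultimately show ?thesis by simp
qed

lemma decidable_le:
  assumes "computable f" "computable g" shows "decidable (\<lambda>x. f x \<le> g x)"
proof -
  have "computable (\<lambda>x. 1 - (f x - g x))"
    using assms by (intro computable_diff computable_const)
  moreover have "1 - (f x - g x) = of_bool (f x \<le> g x)" for x by simp
  ultimately show ?thesis unfolding decidable_def by simp
qed

lemma decidable_not:
  assumes "decidable P" shows "decidable (\<lambda>x. \<not> P x)"
proof -
  have "computable (\<lambda>x. 1 - of_bool (P x))"
    using assms unfolding decidable_def by (intro computable_diff computable_const)
  moreover have "1 - of_bool (P x) = (of_bool (\<not> P x) :: nat)" for x by simp
  ultimately show ?thesis unfolding decidable_def by simp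
qed

lemma decidable_conj:
  assumes "decidable P" "decidable Q" shows "decidable (\<lambda>x. P x \<and> Q x)"
  using computable_mult[OF assms[unfolded decidable_def]]
  unfolding decidable_def by (simp add: of_bool_conj)

lemma decidable_disj:
  assumes "decidable P" "decidable Q" shows "decidable (\<lambda>x. P x \<or> Q x)"
  using decidable_not[OF decidable_conj[OF decidable_not decidable_not, OF assms]] by simp

lemma decidable_less:
  assumes "computable f" "computable g" shows "decidable (\<lambda>x. f x < g x)"
  using decidable_not[OF decidable_le[OF assms(2,1)]] by (simp add: not_le)

lemma decidable_eq:
  assumes "computable f" "computable g" shows "decidable (\<lambda>x. f x = g x)"
  using decidable_conj[OF decidable_le[OF assms] decidable_le[OF assms(2,1)]]
  by (simp add: eq_iff[symmetric])

lemma decidable_comp: "decidable P \<Longrightarrow> computable f \<Longrightarrow> decidable (\<lambda>x. P (f x))"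
  unfolding decidable_def by (rule computable_comp)

text \<open>The truth value of a bounded universal quantifier is a product of truth values, computed
  by recursion on the bound.\<close>

lemma decidable_ball:
  assumes "decidable (\<lambda>z. P (left z) (right z))" "computable h"
  shows "decidable (\<lambda>x. \<forall>k<h x. P x k)"
proof -
  have "computable (\<lambda>x. rec_nat 1 (\<lambda>m y. of_bool (P x m) * y) (h x))"
  proof (intro computable_rec computable_basic computable_mult assms)
    show "computable (\<lambda>x. of_bool (P (left x) (left (right x))))"
      using computable_comp[OF assms(1)[unfolded decidable_def],
          of "\<lambda>x. pair (left x) (left (right x))"]
      by (simp add: computable_basic)
  qed
  moreover have "rec_nat 1 (\<lambda>m y. of_bool (P x m) * y) n = (of_bool (\<forall>k<n. P x k) :: nat)" for x n
    by (induction n) (auto simp: less_Suc_eq)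
  ultimately show ?thesis unfolding decidable_def by simp
qed

text \<open>This plays the role of Goedel's beta function.\<close>

definition entry :: "nat \<Rightarrow> nat \<Rightarrow> nat" where
  "entry c k = left (rec_nat c (\<lambda>_. right) k)"

lemma computable_entry:
  assumes "computable f" "computable g" shows "computable (\<lambda>x. entry (f x) (g x))"
  unfolding entry_def by (intro computable_basic computable_rec assms)

lemma entry_pair: "entry (pair a c) 0 = a" "entry (pair a c) (Suc k) = entry c k"
proof -
  have "rec_nat (pair a c) (\<lambda>_. right) (Suc k) = rec_nat c (\<lambda>_. right) k"
    by (induction k) auto
  then show "entry (pair a c) (Suc k) = entry c k" unfolding entry_def by simp
qed (simp add: entry_def)

lemma entry_exists: "\<exists>c. \<forall>k<n. entry c k = f k"
proof (induction n arbitrary: f)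
  case (Suc n)
  from Suc[of "\<lambda>k. f (Suc k)"] obtain c where "\<forall>k<n. entry c k = f (Suc k)" by blast
  then have "\<forall>k<Suc n. entry (pair (f 0) c) k = f k"
    by (auto simp: entry_pair less_Suc_eq_0_disj)
  then show ?case by blast
qed simp

text \<open>Projections of decidable predicates are used instead of domains of programs, so that the
  closure properties need no construction of programs; \<open>re_W\<close> and \<open>smn\<close>
  connect the two views.\<close>

definition re :: "(nat \<Rightarrow> bool) \<Rightarrow> bool" where
  "re P \<longleftrightarrow> (\<exists>Q. decidable Q \<and> (\<forall>x. P x \<longleftrightarrow> (\<exists>t. Q (pair x t))))"

lemma re_decidable:
  assumes "decidable P" shows "re P"
  unfolding re_def using decidable_comp[OF assms, of left]
  by (intro exI[of _ "\<lambda>z. P (left z)"]) (simp add: computable_basic)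

lemma re_comp:
  assumes "re P" "computable f" shows "re (\<lambda>x. P (f x))"
proof -
  from assms(1) obtain Q where Q: "decidable Q" "\<And>x. P x \<longleftrightarrow> (\<exists>t. Q (pair x t))"
    unfolding re_def by blast
  have "decidable (\<lambda>z. Q (pair (f (left z)) (right z)))"
    by (intro decidable_comp[OF Q(1)] computable_basic computable_comp[OF assms(2)])
  then show ?thesis unfolding re_def
    by (intro exI[of _ "\<lambda>z. Q (pair (f (left z)) (right z))"]) (simp add: Q(2))
qed

lemma re_ex:
  assumes "re (\<lambda>z. P (left z) (right z))" shows "re (\<lambda>x. \<exists>k. P x k)"
proof -
  from assms obtain Q where Q: "decidable Q"
      "\<And>z. P (left z) (right z) \<longleftrightarrow> (\<exists>t. Q (pair z t))"
    unfolding re_def by blast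
  \<comment> \<open>The witness and the stage of its verification are merged into one number, which
    \<open>?f\<close> takes apart again.\<close>
  let ?f = "\<lambda>z. pair (pair (left z) (left (right z))) (right (right z))"
  have "decidable (\<lambda>z. Q (?f z))"
    by (intro decidable_comp[OF Q(1)] computable_basic)
  moreover have "(\<exists>k. P x k) \<longleftrightarrow> (\<exists>t. Q (?f (pair x t)))" for x
  proof -
    have "P x k \<longleftrightarrow> (\<exists>t. Q (pair (pair x k) t))" for k
      using Q(2)[of "pair x k"] by simp
    then have "(\<exists>k. P x k) \<longleftrightarrow> (\<exists>k t. Q (pair (pair x k) t))" by simp
    also have "\<dots> \<longleftrightarrow> (\<exists>t. Q (?f (pair x t)))"
    proof
      assume "\<exists>k t. Q (pair (pair x k) t)"
      then obtain k t where "Q (pair (pair x k) t)" by blast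
      then show "\<exists>t. Q (?f (pair x t))" by (intro exI[of _ "pair k t"]) simp
    qed auto
    finally show ?thesis .
  qed
  ultimately show ?thesis unfolding re_def by blast
qed

lemma re_conj:
  assumes "re P" "re Q" shows "re (\<lambda>x. P x \<and> Q x)"
proof -
  from assms obtain P' Q' where *: "decidable P'" "\<And>x. P x \<longleftrightarrow> (\<exists>t. P' (pair x t))"
      "decidable Q'" "\<And>x. Q x \<longleftrightarrow> (\<exists>t. Q' (pair x t))"
    unfolding re_def by blast
  have "re (\<lambda>x. \<exists>t u. P' (pair x t) \<and> Q' (pair x u))"
    by (intro re_ex re_decidable decidable_conj decidable_comp[OF *(1)] decidable_comp[OF *(3)]
        computable_basic)
  then show ?thesis by (simp add: *)
qed

lemma re_disj:
  assumes "re P" "re Q" shows "re (\<lambda>x. P x \<or> Q x)"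
proof -
  from assms obtain P' Q' where *: "decidable P'" "\<And>x. P x \<longleftrightarrow> (\<exists>t. P' (pair x t))"
      "decidable Q'" "\<And>x. Q x \<longleftrightarrow> (\<exists>t. Q' (pair x t))"
    unfolding re_def by blast
  have "re (\<lambda>x. \<exists>t. P' (pair x t) \<or> Q' (pair x t))"
    by (intro re_ex re_decidable decidable_disj decidable_comp[OF *(1)] decidable_comp[OF *(3)]
        computable_basic)
  then show ?thesis by (simp add: * ex_disj_distrib)
qed

text \<open>Each of the finitely many instances has its own witness; a single number
  \<open>c\<close>, read through \<open>entry\<close>, codes them all. This leaves one unbounded
  quantifier in front of a decidable bounded one.\<close>

lemma re_ball:
  assumes "re (\<lambda>z. P (left z) (right z))" "computable h"
  shows "re (\<lambda>x. \<forall>k<h x. P x k)"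
proof -
  from assms obtain Q where Q: "decidable Q"
      "\<And>z. P (left z) (right z) \<longleftrightarrow> (\<exists>t. Q (pair z t))"
    unfolding re_def by blast
  have P: "P x k \<longleftrightarrow> (\<exists>t. Q (pair (pair x k) t))" for x k using Q(2)[of "pair x k"] by simp
  have "re (\<lambda>x. \<exists>c. \<forall>k<h x. Q (pair (pair x k) (entry c k)))"
    by (intro re_ex re_decidable decidable_ball decidable_comp[OF Q(1)]
        computable_basic computable_entry computable_comp[OF assms(2)])
  moreover have "(\<exists>c. \<forall>k<h x. Q (pair (pair x k) (entry c k))) \<longleftrightarrow> (\<forall>k<h x. P x k)" for x
  proof
    assume "\<forall>k<h x. P x k"
    then obtain f where f: "\<forall>k<h x. Q (pair (pair x k) (f k))" unfolding P by metis
    obtain c where "\<forall>k<h x. entry c k = f k" using entry_exists by blast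
    with f show "\<exists>c. \<forall>k<h x. Q (pair (pair x k) (entry c k))" by metis
  qed (auto simp: P)
  ultimately show ?thesis by simp
qed

lemmas re_intros = re_ex re_conj re_disj
lemmas computable_intros = computable_basic computable_add computable_mult computable_power2 computable_entry

section \<open>Enumerability of inductively generated sets\<close>

inductive derivable :: "(nat \<Rightarrow> bool) \<Rightarrow> (nat \<Rightarrow> nat \<Rightarrow> nat \<Rightarrow> bool) \<Rightarrow> nat \<Rightarrow> bool"
  for R0 R where
  "R0 c \<Longrightarrow> derivable R0 R c"
| "derivable R0 R a \<Longrightarrow> derivable R0 R b \<Longrightarrow> R a b c \<Longrightarrow> derivable R0 R c"

text \<open>A derivation is a finite list in which every entry is an axiom or follows from two
  earlier entries. Such lists are coded by numbers through \<open>entry\<close>, and being a correct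
  list is enumerable.\<close>

lemma re_derivable:
  assumes "re R0" "re (\<lambda>z. R (left z) (left (right z)) (right (right z)))"
  shows "re (derivable R0 R)"
proof -
  let ?step = "\<lambda>d k. R0 (entry d k) \<or>
      (\<exists>i j. (i < k \<and> j < k) \<and> R (entry d i) (entry d j) (entry d k))"
  \<comment> \<open>\<open>S\<close> is \<open>?step\<close> for lists given as functions. These can
    be concatenated directly and are coded only at the end.\<close>
  define S where "S = (\<lambda>f k. R0 (f k) \<or>
      (\<exists>i j. (i < k \<and> j < k) \<and> R (f i) (f j) ((f::nat\<Rightarrow>nat) k)))"
  have R: "re (\<lambda>z. R (f z) (g z) (h z))" if "computable f" "computable g" "computable h" for f g h
    using re_comp[OF assms(2), of "\<lambda>z. pair (f z) (pair (g z) (h z))"] that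
    by (simp add: computable_basic)
  have "re (\<lambda>c. \<exists>d n. entry d n = c \<and> (\<forall>k<Suc n. ?step d k))"
    by (intro re_intros re_ball R re_comp[OF assms(1)]
        re_decidable[OF decidable_eq] re_decidable[OF decidable_conj] decidable_less computable_intros)
  moreover have "(\<exists>d n. entry d n = c \<and> (\<forall>k<Suc n. ?step d k)) \<longleftrightarrow> derivable R0 R c" for c
  proof
    assume "\<exists>d n. entry d n = c \<and> (\<forall>k<Suc n. ?step d k)"
    then obtain d n where d: "entry d n = c" "\<forall>k<Suc n. ?step d k" by blast
    have "derivable R0 R (entry d k)" if "k < Suc n" for k
      using that
    proof (induction k rule: less_induct)
      case (less k)
      with d(2) have "?step d k" by blast
      then show ?case using less by (fastforce intro: derivable.intros)
    qed
    with d(1) show "derivable R0 R c" by blast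
  next
    assume "derivable R0 R c"
    then have "\<exists>f n. f n = c \<and> (\<forall>k<Suc n. S f k)"
    proof induction
      case (1 c)
      then show ?case by (intro exI[of _ "\<lambda>_. c"] exI[of _ 0]) (auto simp: S_def)
    next
      case (2 a b c)
      then obtain f n g m where f: "f n = a" "\<And>k. k < Suc n \<Longrightarrow> S f k"
        and g: "g m = b" "\<And>k. k < Suc m \<Longrightarrow> S g k" by blast
      \<comment> \<open>The two derivations are put one after the other, followed by
        \<open>c\<close>; positions in the second one move up by \<open>Suc n\<close>.\<close>
      define h where "h k = (if k < Suc n then f k
          else if k < Suc n + Suc m then g (k - Suc n) else c)" for k
      have "S h k" if k: "k < Suc (Suc n + Suc m)" for k
      proof -
        consider "k < Suc n" | i where "k = Suc n + i" "i < Suc m" | "k = Suc n + Suc m"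
          using k by (metis add_diff_inverse_nat less_SucE nat_add_left_cancel_less)
        then show ?thesis
        proof cases
          case 1
          then show ?thesis using f(2)[of k] unfolding S_def h_def by (fastforce)
        next
          case (2 i)
          from g(2)[OF 2(2)] consider "R0 (g i)"
            | p q where "p < i" "q < i" "R (g p) (g q) (g i)"
            unfolding S_def by blast
          then show ?thesis
          proof cases
            case 1
            then show ?thesis using 2 unfolding S_def h_def by simp
          next
            case (2 p q)
            with \<open>k = Suc n + i\<close> \<open>i < Suc m\<close> show ?thesis unfolding S_def h_def
              by (intro disjI2 exI[of _ "Suc n + p"] exI[of _ "Suc n + q"]) simp
          qed
        next
          case 3
          then show ?thesis using f(1) g(1) \<open>R a b c\<close> unfolding S_def h_def
            by (intro disjI2 exI[of _ n] exI[of _ "Suc n + m"]) simp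
        qed
      qed
      moreover have "h (Suc n + Suc m) = c" unfolding h_def by simp
      ultimately show ?case by blast
    qed
    then obtain f n where f: "f n = c" "\<forall>k<Suc n. S f k" by blast
    obtain d where d: "\<forall>k<Suc n. entry d k = f k" using entry_exists by blast
    then have "\<forall>k<Suc n. ?step d k" using f(2) unfolding S_def by (metis less_trans)
    moreover have "entry d n = c" using d f(1) by simp
    ultimately show "\<exists>d n. entry d n = c \<and> (\<forall>k<Suc n. ?step d k)" by blast
  qed
  ultimately show ?thesis by simp
qed

subsection \<open>The universal function and parametrization\<close>

text \<open>The graph of the universal function is generated by rules with at most two premises. The
  facts of the first kind say that a number codes a program: evaluating \<open>PrimRec f g\<close> at recursion
  argument \<open>0\<close> never runs \<open>g\<close>, so without them invalid codes of \<open>g\<close> would be accepted.\<close>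

definition valid_fact :: "nat \<Rightarrow> nat" where "valid_fact e = pair 0 e"
definition eval_fact :: "nat \<Rightarrow> nat \<Rightarrow> nat \<Rightarrow> nat" where
  "eval_fact e x y = pair 1 (pair e (pair x y))"
text \<open>Such a fact records that the search of \<open>Minimize\<close> has passed all numbers
  below \<open>n\<close>, that is, that the values found there are positive (see
  \<open>sound_fact\<close>). It splits the search into steps with two premises each.\<close>

definition search_fact :: "nat \<Rightarrow> nat \<Rightarrow> nat \<Rightarrow> nat" where
  "search_fact e x n = pair 2 (pair e (pair x n))"

lemmas fact_defs = valid_fact_def eval_fact_def search_fact_def

lemma fact_eq:
  "valid_fact e = valid_fact e' \<longleftrightarrow> e = e'"
  "eval_fact e x y = eval_fact e' x' y' \<longleftrightarrow> e = e' \<and> x = x' \<and> y = y'"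
  "search_fact e x y = search_fact e' x' y' \<longleftrightarrow> e = e' \<and> x = x' \<and> y = y'"
  "valid_fact e \<noteq> eval_fact e' x' y'" "valid_fact e \<noteq> search_fact e' x' y'"
  "eval_fact e x y \<noteq> valid_fact e'" "eval_fact e x y \<noteq> search_fact e' x' y'"
  "search_fact e x y \<noteq> valid_fact e'" "search_fact e x y \<noteq> eval_fact e' x' y'"
  by (auto simp: fact_defs prod_encode_eq)

definition run_axiom :: "nat \<Rightarrow> bool" where
  "run_axiom c \<longleftrightarrow>
     (\<exists>i. i < 4 \<and> c = valid_fact (pair i 0)) \<or>
     (\<exists>x. c = eval_fact (pair 0 0) x 0) \<or>
     (\<exists>x. c = eval_fact (pair 1 0) x (Suc x)) \<or>
     (\<exists>x. c = eval_fact (pair 2 0) x (left x)) \<or>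
     (\<exists>x. c = eval_fact (pair 3 0) x (right x))"

text \<open>A disjunct that mentions only \<open>a\<close> is a rule with one premise; it can be
  applied with any derivable fact as \<open>b\<close>. The last three disjuncts start, continue and
  finish the search of \<open>Minimize\<close>.\<close>

definition run_rule :: "nat \<Rightarrow> nat \<Rightarrow> nat \<Rightarrow> bool" where
  "run_rule a b c \<longleftrightarrow>
     (\<exists>f g i. a = valid_fact f \<and> b = valid_fact g \<and> (4 \<le> i \<and> i \<le> 6) \<and>
        c = valid_fact (pair i (pair f g))) \<or>
     (\<exists>f. a = valid_fact f \<and> c = valid_fact (pair 7 f)) \<or>
     (\<exists>f g x u v. a = eval_fact f x u \<and> b = eval_fact g x v \<and>
        c = eval_fact (pair 4 (pair f g)) x (pair u v)) \<or>
     (\<exists>f g x u v. a = eval_fact g x u \<and> b = eval_fact f u v \<and>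
        c = eval_fact (pair 5 (pair f g)) x v) \<or>
     (\<exists>f g x y. a = eval_fact f x y \<and> b = valid_fact g \<and>
        c = eval_fact (pair 6 (pair f g)) (pair x 0) y) \<or>
     (\<exists>f g x n y z. a = eval_fact (pair 6 (pair f g)) (pair x n) y \<and>
        b = eval_fact g (pair x (pair n y)) z \<and>
        c = eval_fact (pair 6 (pair f g)) (pair x (Suc n)) z) \<or>
     (\<exists>f x. a = valid_fact f \<and> c = search_fact f x 0) \<or>
     (\<exists>f x n y. a = search_fact f x n \<and> b = eval_fact f (pair x n) (Suc y) \<and>
        c = search_fact f x (Suc n)) \<or>
     (\<exists>f x n. a = search_fact f x n \<and> b = eval_fact f (pair x n) 0 \<and>
        c = eval_fact (pair 7 f) x n)"

abbreviation "run_derivable \<equiv> derivable run_axiom run_rule"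

lemma re_run_derivable: "re run_derivable"
proof (rule re_derivable)
  show "re run_axiom"
    unfolding run_axiom_def fact_defs
    by (intro re_intros re_decidable[OF decidable_eq] re_decidable[OF decidable_less] computable_intros)
  show "re (\<lambda>z. run_rule (left z) (left (right z)) (right (right z)))"
    unfolding run_rule_def fact_defs
    by (intro re_intros re_decidable[OF decidable_eq] re_decidable[OF decidable_le] computable_intros)
qed

lemma valid_derivable: "run_derivable (valid_fact (godel p))"
proof (induction p)
  case Zero show ?case
    by (rule derivable.intros(1)) (auto simp: run_axiom_def fact_eq prod_encode_eq)
next
  case Succ show ?case
    by (rule derivable.intros(1)) (auto simp: run_axiom_def fact_eq prod_encode_eq)
next
  case ProjL show ?case
    by (rule derivable.intros(1)) (auto simp: run_axiom_def fact_eq prod_encode_eq)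
next
  case ProjR show ?case
    by (rule derivable.intros(1)) (auto simp: run_axiom_def fact_eq prod_encode_eq)
next
  case (Pairing p q) then show ?case
    by (rule derivable.intros(2)) (auto simp: run_rule_def fact_eq prod_encode_eq)
next
  case (Compose p q) then show ?case
    by (rule derivable.intros(2)) (auto simp: run_rule_def fact_eq prod_encode_eq)
next
  case (PrimRec p q) then show ?case
    by (rule derivable.intros(2)) (auto simp: run_rule_def fact_eq prod_encode_eq)
next
  case (Minimize p) from this this show ?case
    by (rule derivable.intros(2)) (auto simp: run_rule_def fact_eq prod_encode_eq)
qed

lemma eval_derivable: "run p x = Some y \<Longrightarrow> run_derivable (eval_fact (godel p) x y)"
proof (induction p arbitrary: x y)
  case Zero then show ?case
    by (intro derivable.intros(1)) (auto simp: run_axiom_def fact_eq prod_encode_eq)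
next
  case Succ then show ?case
    by (intro derivable.intros(1)) (auto simp: run_axiom_def fact_eq prod_encode_eq)
next
  case ProjL then show ?case
    by (intro derivable.intros(1)) (auto simp: run_axiom_def fact_eq prod_encode_eq)
next
  case ProjR then show ?case
    by (intro derivable.intros(1)) (auto simp: run_axiom_def fact_eq prod_encode_eq)
next
  case (Pairing p q)
  from Pairing.prems obtain u v where uv: "run p x = Some u" "run q x = Some v" "y = pair u v"
    by (auto split: Option.bind_splits)
  show ?case
    by (rule derivable.intros(2)[OF Pairing.IH(1)[OF uv(1)] Pairing.IH(2)[OF uv(2)]])
      (auto simp: run_rule_def fact_eq prod_encode_eq uv)
next
  case (Compose p q)
  from Compose.prems obtain u where u: "run q x = Some u" "run p u = Some y"
    by (auto split: Option.bind_splits)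
  show ?case
    by (rule derivable.intros(2)[OF Compose.IH(2)[OF u(1)] Compose.IH(1)[OF u(2)]])
      (auto simp: run_rule_def fact_eq prod_encode_eq)
next
  case (PrimRec p q)
  obtain a n where x: "x = pair a n" by (metis prod.collapse prod_decode_inverse)
  from PrimRec.prems[unfolded x] show ?case unfolding x
  proof (induction n arbitrary: y)
    case 0
    then have "run p a = Some y" by simp
    show ?case
      by (rule derivable.intros(2)[OF PrimRec.IH(1)[OF \<open>run p a = Some y\<close>] valid_derivable[of q]])
        (auto simp: run_rule_def fact_eq prod_encode_eq)
  next
    case (Suc n)
    then obtain u where u: "run (PrimRec p q) (pair a n) = Some u"
        "run q (pair a (pair n u)) = Some y"
      by (auto split: Option.bind_splits)
    show ?case
      by (rule derivable.intros(2)[OF Suc.IH[OF u(1)] PrimRec.IH(2)[OF u(2)]])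
        (auto simp: run_rule_def fact_eq prod_encode_eq)
  qed
next
  case (Minimize p)
  from Minimize.prems obtain n where n: "run p (pair x n) = Some 0"
      "\<And>m. m < n \<Longrightarrow> \<exists>y. run p (pair x m) = Some (Suc y)"
      and y: "y = (LEAST n. run p (pair x n) = Some 0)"
    by (auto split: if_splits)
  have "y = n" unfolding y using n by (intro Least_equality) (force simp: not_less[symmetric])+
  \<comment> \<open>The search facts climb to the zero \<open>n\<close>, each step using the
    positive value that has just been passed.\<close>
  have "run_derivable (search_fact (godel p) x m)" if "m \<le> n" for m
    using that
  proof (induction m)
    case 0 show ?case
      by (rule derivable.intros(2)[OF valid_derivable[of p] valid_derivable[of p]])
        (auto simp: run_rule_def fact_eq prod_encode_eq)
  next
    case (Suc m)
    with n(2) obtain u where u: "run p (pair x m) = Some (Suc u)" by fastforce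
    have "run_derivable (search_fact (godel p) x m)" using Suc by simp
    then show ?case
      by (rule derivable.intros(2)[OF _ Minimize.IH[OF u]]) (auto simp: run_rule_def fact_eq prod_encode_eq)
  qed
  from derivable.intros(2)[OF this[OF order_refl] Minimize.IH[OF n(1)]]
  show ?case by (auto simp: run_rule_def fact_eq prod_encode_eq \<open>y = n\<close>)
qed

text \<open>This is the invariant of the soundness proof. It is stated for all numbers so that rule
  induction applies; numbers that are not facts satisfy it vacuously.\<close>

definition sound_fact :: "nat \<Rightarrow> bool" where
  "sound_fact c \<longleftrightarrow>
     (\<forall>e. c = valid_fact e \<longrightarrow> (\<exists>p. godel p = e)) \<and>
     (\<forall>e x y. c = eval_fact e x y \<longrightarrow> phi e x y) \<and>
     (\<forall>e x n. c = search_fact e x n \<longrightarrow>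
        (\<exists>p. godel p = e \<and> (\<forall>m<n. \<exists>y. run p (pair x m) = Some (Suc y))))"

lemma sound_fact_simps:
  "sound_fact (valid_fact e) \<longleftrightarrow> (\<exists>p. godel p = e)"
  "sound_fact (eval_fact e x y) \<longleftrightarrow> (\<exists>p. godel p = e \<and> run p x = Some y)"
  "sound_fact (search_fact e x n) \<longleftrightarrow>
     (\<exists>p. godel p = e \<and> (\<forall>m<n. \<exists>y. run p (pair x m) = Some (Suc y)))"
  unfolding sound_fact_def phi_def by (auto simp: fact_eq)

lemma godel_cases:
  "godel p = pair 6 (pair (godel f) (godel g)) \<longleftrightarrow> p = PrimRec f g"
  "godel p = pair 6 (pair a b) \<longleftrightarrow> (\<exists>f g. p = PrimRec f g \<and> a = godel f \<and> b = godel g)"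
  by (cases p; auto simp: prod_encode_eq dest: injD[OF inj_godel])+

lemma derivable_sound: "run_derivable c \<Longrightarrow> sound_fact c"
proof (induction rule: derivable.induct)
  case (1 c)
  then show ?case unfolding run_axiom_def
  proof (elim disjE exE conjE)
    fix i assume "i < (4::nat)" "c = valid_fact (pair i 0)"
    from this(1) consider "i = 0" | "i = 1" | "i = 2" | "i = 3" by linarith
    then show ?thesis using \<open>c = _\<close>
      by cases (auto simp: sound_fact_simps intro: exI[of _ Zero] exI[of _ Succ] exI[of _ ProjL] exI[of _ ProjR])
  qed (auto simp: sound_fact_simps intro: exI[of _ Zero] exI[of _ Succ] exI[of _ ProjL] exI[of _ ProjR])
next
  case (2 a b c)
  from "2.hyps"(3) show ?case unfolding run_rule_def
  proof (elim disjE exE conjE)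
    fix f g i assume *: "a = valid_fact f" "b = valid_fact g" "4 \<le> i" "i \<le> (6::nat)"
      "c = valid_fact (pair i (pair f g))"
    from "2.IH" obtain p q where "godel p = f" "godel q = g" by (auto simp: * sound_fact_simps)
    from *(3,4) consider "i = 4" | "i = 5" | "i = 6" by linarith
    then show ?thesis using \<open>godel p = f\<close> \<open>godel q = g\<close>
      by cases (auto simp: * sound_fact_simps intro: exI[of _ "Pairing p q"] exI[of _ "Compose p q"]
          exI[of _ "PrimRec p q"])
  next
    fix f assume *: "a = valid_fact f" "c = valid_fact (pair 7 f)"
    from "2.IH" obtain p where "godel p = f" by (auto simp: * sound_fact_simps)
    then show ?thesis by (auto simp: * sound_fact_simps intro: exI[of _ "Minimize p"])
  next
    fix f g x u v assume *: "a = eval_fact f x u" "b = eval_fact g x v"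
        "c = eval_fact (pair 4 (pair f g)) x (pair u v)"
    from "2.IH" obtain p q where "godel p = f" "godel q = g" "run p x = Some u" "run q x = Some v"
      by (auto simp: * sound_fact_simps)
    then show ?thesis by (auto simp: * sound_fact_simps intro!: exI[of _ "Pairing p q"])
  next
    fix f g x u v assume *: "a = eval_fact g x u" "b = eval_fact f u v"
        "c = eval_fact (pair 5 (pair f g)) x v"
    from "2.IH" obtain p q where "godel p = f" "godel q = g" "run q x = Some u" "run p u = Some v"
      by (auto simp: * sound_fact_simps)
    then show ?thesis by (auto simp: * sound_fact_simps intro!: exI[of _ "Compose p q"])
  next
    fix f g x y assume *: "a = eval_fact f x y" "b = valid_fact g"
        "c = eval_fact (pair 6 (pair f g)) (pair x 0) y"
    from "2.IH" obtain p q where "godel p = f" "godel q = g" "run p x = Some y"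
      by (auto simp: * sound_fact_simps)
    then show ?thesis by (auto simp: * sound_fact_simps intro!: exI[of _ "PrimRec p q"])
  next
    fix f g x n y z assume *: "a = eval_fact (pair 6 (pair f g)) (pair x n) y"
        "b = eval_fact g (pair x (pair n y)) z"
        "c = eval_fact (pair 6 (pair f g)) (pair x (Suc n)) z"
    from "2.IH" obtain r q where rq: "godel r = pair 6 (pair f g)" "run r (pair x n) = Some y"
        "godel q = g" "run q (pair x (pair n y)) = Some z"
      by (auto simp: * sound_fact_simps)
    \<comment> \<open>The code of \<open>r\<close> has tag 6, so \<open>r\<close> is a primitive
      recursion, and injectivity of \<open>godel\<close> identifies its step program with
      \<open>q\<close>.\<close>
    then obtain p where "r = PrimRec p q" "f = godel p"
      by (auto simp: godel_cases dest: injD[OF inj_godel])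
    with rq show ?thesis by (auto simp: * sound_fact_simps intro!: exI[of _ "PrimRec p q"])
  next
    fix f x assume *: "a = valid_fact f" "c = search_fact f x 0"
    from "2.IH" show ?thesis by (auto simp: * sound_fact_simps)
  next
    fix f x n y assume *: "a = search_fact f x n" "b = eval_fact f (pair x n) (Suc y)"
        "c = search_fact f x (Suc n)"
    from "2.IH" obtain p where "godel p = f" "run p (pair x n) = Some (Suc y)"
        "\<forall>m<n. \<exists>y. run p (pair x m) = Some (Suc y)"
      by (auto simp: * sound_fact_simps dest: injD[OF inj_godel])
    then show ?thesis by (auto simp: * sound_fact_simps less_Suc_eq)
  next
    fix f x n assume *: "a = search_fact f x n" "b = eval_fact f (pair x n) 0"
        "c = eval_fact (pair 7 f) x n"
    from "2.IH" obtain p where p: "godel p = f" "run p (pair x n) = Some 0"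
        "\<forall>m<n. \<exists>y. run p (pair x m) = Some (Suc y)"
      by (auto simp: * sound_fact_simps dest: injD[OF inj_godel])
    \<comment> \<open>The search fact says that all earlier values are positive, so the first zero
      is at \<open>n\<close>.\<close>
    have "(LEAST n. run p (pair x n) = Some 0) = n"
      using p by (intro Least_equality) (force simp: not_less[symmetric])+
    with p have "run (Minimize p) x = Some n" by auto
    with p(1) show ?thesis by (auto simp: * sound_fact_simps intro!: exI[of _ "Minimize p"])
  qed
qed

lemma re_phi:
  assumes "computable e" "computable f" "computable g"
  shows "re (\<lambda>z. phi (e z) (f z) (g z))"
proof -
  have "phi a x y \<longleftrightarrow> run_derivable (eval_fact a x y)" for a x y
    using derivable_sound[of "eval_fact a x y"] eval_derivable
    by (auto simp: phi_def sound_fact_simps)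
  moreover have "re (\<lambda>z. run_derivable (eval_fact (e z) (f z) (g z)))"
    unfolding eval_fact_def by (intro re_comp[OF re_run_derivable] computable_basic assms)
  ultimately show ?thesis by simp
qed

lemma re_W:
  assumes "computable e" "computable f"
  shows "re (\<lambda>z. f z \<in> W (e z))"
  unfolding W_def mem_Collect_eq
  by (intro re_intros re_phi computable_comp[OF assms(1)] computable_comp[OF assms(2)] computable_intros)

section \<open>The s-m-n theorem\<close>

primrec const_prog :: "nat \<Rightarrow> prog" where
  "const_prog 0 = Zero"
| "const_prog (Suc n) = Compose Succ (const_prog n)"

lemma run_const_prog: "run (const_prog n) x = Some n"
  by (induction n) auto

lemma computable_godel_const_prog: "computable (\<lambda>n. godel (const_prog n))"
proof -
  have "computable (\<lambda>n. rec_nat (godel Zero) (\<lambda>_ y. pair 5 (pair (godel Succ) y)) n)"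
    by (intro computable_rec computable_basic)
  moreover have "rec_nat (godel Zero) (\<lambda>_ y. pair 5 (pair (godel Succ) y)) n = godel (const_prog n)" for n
    by (induction n) auto
  ultimately show ?thesis by simp
qed

lemma W_godel: "W (godel p) = {x. run p x \<noteq> None}"
  unfolding W_def phi_def by (auto dest: injD[OF inj_godel])

text \<open>The program searches for a stage \<open>t\<close> at which \<open>Q\<close> holds, with
  \<open>j\<close> hard-wired by \<open>const_prog\<close>. Only this constant depends on
  \<open>j\<close>, so the code of the whole program is a computable function of
  \<open>j\<close>.\<close>

lemma smn:
  assumes "re (\<lambda>z. R (left z) (right z))"
  obtains g where "computable g" "\<And>j. W (g j) = {x. R j x}"
proof -
  from assms obtain Q where Q: "decidable Q" "\<And>z. R (left z) (right z) \<longleftrightarrow> (\<exists>t. Q (pair z t))"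
    unfolding re_def by blast
  \<comment> \<open>\<open>Minimize\<close> looks for a zero, hence the negated truth value.\<close>
  obtain q where q: "\<And>z. run q z = Some (of_bool (\<not> Q z))"
    using decidable_not[OF Q(1)] unfolding decidable_def computable_iff by blast
  let ?p = "\<lambda>j. Compose (Minimize q) (Pairing (const_prog j) (Pairing ProjL ProjR))"
  have "run (?p j) x \<noteq> None \<longleftrightarrow> R j x" for j x
  proof
    assume "R j x"
    then have ex: "\<exists>t. Q (pair (pair j x) t)" using Q(2)[of "pair j x"] by simp
    define t where "t = (LEAST t. Q (pair (pair j x) t))"
    have "Q (pair (pair j x) t)" unfolding t_def using ex by (rule LeastI_ex)
    moreover have "\<not> Q (pair (pair j x) m)" if "m < t" for m
      using that unfolding t_def by (rule not_less_Least)
    ultimately have "\<exists>n. run q (pair (pair j x) n) = Some 0 \<and>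
        (\<forall>m<n. \<exists>y. run q (pair (pair j x) m) = Some (Suc y))"
      by (intro exI[of _ t]) (auto simp: q)
    then show "run (?p j) x \<noteq> None" by (simp add: run_const_prog)
  next
    assume "run (?p j) x \<noteq> None"
    then have "\<exists>t. Q (pair (pair j x) t)" 
      by (auto simp: run_const_prog q split: if_splits)
    then show "R j x" using Q(2)[of "pair j x"] by simp
  qed
  then have "W (godel (?p j)) = {x. R j x}" for j unfolding W_godel by blast
  moreover have "computable (\<lambda>j. godel (?p j))"
    unfolding godel.simps by (intro computable_basic computable_godel_const_prog)
  ultimately show ?thesis using that by blast
qed

section \<open>Uniform families of \<open>\<Sigma>\<^sup>0\<^sub>n\<close> sets\<close>

definition radius :: "nat \<Rightarrow> real" where
  "radius j = real (Suc (left j)) / real (Suc (right j))"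

lemma radius_pos: "radius j > 0"
  by (simp add: radius_def)

lemma radius_between:
  assumes "0 \<le> u" "u < v" shows "\<exists>j. u < radius j \<and> radius j < v"
proof -
  from assms(2) obtain r :: nat where r: "inverse (real (Suc r)) < v - u"
    using reals_Archimedean[of "v - u"] by auto
  define p where "p = nat \<lfloor>u * Suc r\<rfloor>"
  have "real p \<le> u * Suc r" "u * Suc r < real p + 1"
    using assms(1) unfolding p_def by (auto simp: of_nat_nat intro: floor_le_iff[THEN iffD1])
  then have "u < real (Suc p) / Suc r" "real p / Suc r \<le> u"
    by (simp_all add: less_divide_eq divide_le_eq)
  moreover have "real (Suc p) / Suc r = real p / Suc r + inverse (real (Suc r))"
    by (simp add: add_divide_distrib inverse_eq_divide)
  ultimately show ?thesis by (intro exI[of _ "pair p r"]) (use r in \<open>auto simp: radius_def\<close>)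
qed

lemma ideal_ball_eq: "ideal_ball s n = {x. dist x (s (left n)) < radius (right n)}"
  unfolding ideal_ball_def pos_rat_enum_def radius_def
  by (simp add: case_prod_beta of_rat_divide of_rat_add)

lemma rat_enum_eq:
  "real_of_rat (rat_enum m) = real_of_int (int_decode (left m)) / real (Suc (right m))"
  unfolding rat_enum_def by (simp add: case_prod_beta of_rat_divide of_rat_add)

text \<open>Odd codes stand for negative integers, and \<open>2 * k\<close> stands for
  \<open>k\<close>. Comparison with a natural number is thus expressed by equations and inequalities
  between codes, as the enumerability lemmas require.\<close>

lemma int_decode_le_iff: "int_decode a \<le> int n \<longleftrightarrow> (\<exists>k. a = 2 * k + 1) \<or> a \<le> 2 * n"
  unfolding int_decode_def sum_decode_def by (auto elim!: evenE oddE) presburger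

lemma int_decode_ge_iff: "int n \<le> int_decode a \<longleftrightarrow> (\<exists>k. a = 2 * k \<and> n \<le> k)"
  unfolding int_decode_def sum_decode_def by (auto elim!: evenE oddE) presburger

lemma divide_less_divide_iff:
  "b > 0 \<Longrightarrow> d > 0 \<Longrightarrow> a / b < c / d \<longleftrightarrow> a * d < c * b" for a b c d :: real
  by (simp add: divide_less_eq less_divide_eq mult.commute)

text \<open>Clearing denominators yields a comparison of natural numbers, to which
  \<open>decidable_less\<close> applies.\<close>

lemma fractions_less_iff:
  fixes b c d f :: nat
  assumes "b > 0" "c > 0" "d > 0" "f > 0"
  shows "real a / b + 1 / c + real e / d < real g / f \<longleftrightarrow>
    (a * c * d + b * d + e * (b * c)) * f < g * (b * c * d)"
proof -
  have "real a / b + 1 / c + real e / d = real (a * c * d + b * d + e * (b * c)) / real (b * c * d)"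
    using assms by (simp add: field_simps)
  also have "\<dots> < real g / f \<longleftrightarrow>
      real (a * c * d + b * d + e * (b * c)) * real f < real g * real (b * c * d)"
    using assms by (intro divide_less_divide_iff) simp_all
  finally show ?thesis by (metis of_nat_less_iff of_nat_mult)
qed

definition hits :: "('a \<Rightarrow> 'a) \<Rightarrow> 'a set \<Rightarrow> nat \<Rightarrow> 'a \<Rightarrow> nat" where
  "hits T B N x = card {k \<in> {..<N}. (T ^^ k) x \<in> B}"

section \<open>Enumerability of strict inequalities between distances\<close>

locale computable_metric =
  fixes s :: "nat \<Rightarrow> 'a::polish_space"
  assumes computable_metric: "computable_metric_space s"
begin

lemma dense_point:
  assumes "e > 0" shows "\<exists>i. dist x (s i) < e"
proof -
  have "x \<in> closure (range s)"
    using computable_metric unfolding computable_metric_space_def by simp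
  with assms show ?thesis unfolding closure_approachable by (auto simp: dist_commute)
qed

text \<open>Partial recursive functions are single-valued, so every value that is found, and not
  just some value, is a good approximation.\<close>

lemma dist_approximation:
  obtains f where "computable f"
    "\<And>i j t. \<exists>m. phi (f (pair i j)) t m"
    "\<And>i j t m. phi (f (pair i j)) t m \<Longrightarrow> \<bar>dist (s i) (s j) - of_rat (rat_enum m)\<bar> \<le> 1 / 2 ^ t"
proof -
  from computable_metric obtain f where f: "computable f"
      "\<And>n. let (i, j) = prod_decode n in computable_real_index (f n) (dist (s i) (s j))"
    unfolding computable_metric_space_def uniformly_def by blast
  have *: "computable_real_index (f (pair i j)) (dist (s i) (s j))" for i j
    using f(2)[of "pair i j"] by simp
  have unique: "phi e x y \<Longrightarrow> phi e x y' \<Longrightarrow> y = y'" for e x y y'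
    unfolding phi_def by (auto dest: injD[OF inj_godel])
  show ?thesis
  proof (rule that[OF f(1)])
    show "\<exists>m. phi (f (pair i j)) t m" for i j t
      using * unfolding computable_real_index_def by blast
    show "\<bar>dist (s i) (s j) - of_rat (rat_enum m)\<bar> \<le> 1 / 2 ^ t" if "phi (f (pair i j)) t m" for i j t m
      using *[of i j] unique[OF that] unfolding computable_real_index_def by metis
  qed
qed

lemma inverse_two_power_less:
  assumes "(0::real) < e" shows "\<exists>t::nat. 1 / 2 ^ t < e"
  using real_arch_pow_inv[OF assms, of "1/2"] by (auto simp: power_one_over)

text \<open>A strict inequality is confirmed by some approximation of the distance that leaves room
  for its error \<open>1 / 2 ^ t\<close>. Here \<open>n\<close> is a natural upper bound of the
  numerator of the approximation, which may be negative.\<close>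

lemma re_dist_less:
  assumes "computable a" "computable b" "computable c" "computable d"
  shows "re (\<lambda>z. dist (s (a z)) (s (b z)) + radius (c z) < radius (d z))"
proof -
  obtain f where f: "computable f" "\<And>i j t. \<exists>m. phi (f (pair i j)) t m"
    "\<And>i j t m. phi (f (pair i j)) t m \<Longrightarrow> \<bar>dist (s i) (s j) - of_rat (rat_enum m)\<bar> \<le> 1 / 2 ^ t"
    using dist_approximation by blast
  note comp = computable_comp[OF f(1)] assms[THEN computable_comp]
  let ?L = "\<lambda>t m n c d.
    real n / Suc (right m) + 1 / real (2 ^ t) + real (Suc (left c)) / Suc (right c)
      < real (Suc (left d)) / Suc (right d)"
  have "re (\<lambda>z. \<exists>t m n. phi (f (pair (a z) (b z))) t m \<and>
      ((\<exists>k. left m = 2 * k + 1) \<or> left m \<le> 2 * n) \<and> ?L t m n (c z) (d z))"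
    unfolding fractions_less_iff[OF zero_less_Suc zero_less_power[OF zero_less_numeral]
        zero_less_Suc zero_less_Suc]
    by (intro re_intros re_phi comp re_decidable[OF decidable_eq] re_decidable[OF decidable_le]
        re_decidable[OF decidable_less] computable_intros)
  moreover have "(\<exists>t m n. phi (f (pair i j)) t m \<and>
      ((\<exists>k. left m = 2 * k + 1) \<or> left m \<le> 2 * n) \<and> ?L t m n c d) \<longleftrightarrow>
      dist (s i) (s j) + radius c < radius d" for i j c d
  proof
    assume "\<exists>t m n. phi (f (pair i j)) t m \<and>
      ((\<exists>k. left m = 2 * k + 1) \<or> left m \<le> 2 * n) \<and> ?L t m n c d"
    then obtain t m n where *: "phi (f (pair i j)) t m" "int_decode (left m) \<le> int n" "?L t m n c d"
      unfolding int_decode_le_iff by blast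
    have "real_of_rat (rat_enum m) \<le> real n / Suc (right m)"
      unfolding rat_enum_eq using *(2) by (intro divide_right_mono) linarith+
    with f(3)[OF *(1)] *(3) show "dist (s i) (s j) + radius c < radius d"
      unfolding radius_def by simp
  next
    assume "dist (s i) (s j) + radius c < radius d"
    \<comment> \<open>The gap is halved because the error is counted twice: in the approximation
      itself and as the margin in \<open>?L\<close>.\<close>
    then obtain t where "1 / 2 ^ t < (radius d - radius c - dist (s i) (s j)) / 2"
      using inverse_two_power_less[of "(radius d - radius c - dist (s i) (s j)) / 2"] by auto
    moreover define e :: real where "e = 1 / 2 ^ t"
    ultimately have t: "2 * e < radius d - radius c - dist (s i) (s j)" by simp
    obtain m where m: "phi (f (pair i j)) t m" using f(2) by blast
    define n where "n = nat (int_decode (left m))"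
    have "real n / Suc (right m) \<le> dist (s i) (s j) + e"
    proof (cases "int_decode (left m) \<ge> 0")
      case True
      then have "real n / Suc (right m) = real_of_rat (rat_enum m)"
        unfolding rat_enum_eq n_def by (simp add: of_nat_nat)
      with f(3)[OF m, folded e_def] show ?thesis by simp
    next
      case False
      then show ?thesis unfolding n_def e_def by simp
    qed
    with t have "real n / Suc (right m) + e + radius c < radius d" by linarith
    then have "?L t m n c d" unfolding radius_def e_def by simp
    moreover have "int_decode (left m) \<le> int n" unfolding n_def by simp
    ultimately show "\<exists>t m n. phi (f (pair i j)) t m \<and>
      ((\<exists>k. left m = 2 * k + 1) \<or> left m \<le> 2 * n) \<and> ?L t m n c d"
      using m unfolding int_decode_le_iff by blast
  qed
  ultimately show ?thesis by simp
qed

text \<open>This mirrors \<open>re_dist_less\<close>, with \<open>n\<close> now a lower bound of the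
  numerator.\<close>

lemma re_dist_greater:
  assumes "computable a" "computable b" "computable c" "computable d"
  shows "re (\<lambda>z. radius (c z) + radius (d z) < dist (s (a z)) (s (b z)))"
proof -
  obtain f where f: "computable f" "\<And>i j t. \<exists>m. phi (f (pair i j)) t m"
    "\<And>i j t m. phi (f (pair i j)) t m \<Longrightarrow> \<bar>dist (s i) (s j) - of_rat (rat_enum m)\<bar> \<le> 1 / 2 ^ t"
    using dist_approximation by blast
  note comp = computable_comp[OF f(1)] assms[THEN computable_comp]
  let ?L = "\<lambda>t m n c d.
    real (Suc (left c)) / Suc (right c) + 1 / real (2 ^ t) + real (Suc (left d)) / Suc (right d)
      < real n / Suc (right m)"
  have "re (\<lambda>z. \<exists>t m n. phi (f (pair (a z) (b z))) t m \<and>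
      (\<exists>k. left m = 2 * k \<and> n \<le> k) \<and> ?L t m n (c z) (d z))"
    unfolding fractions_less_iff[OF zero_less_Suc zero_less_power[OF zero_less_numeral]
        zero_less_Suc zero_less_Suc]
    by (intro re_intros re_phi comp re_decidable[OF decidable_eq] re_decidable[OF decidable_le]
        re_decidable[OF decidable_less] computable_intros)
  moreover have "(\<exists>t m n. phi (f (pair i j)) t m \<and>
      (\<exists>k. left m = 2 * k \<and> n \<le> k) \<and> ?L t m n c d) \<longleftrightarrow>
      radius c + radius d < dist (s i) (s j)" for i j c d
  proof
    assume "\<exists>t m n. phi (f (pair i j)) t m \<and>
      (\<exists>k. left m = 2 * k \<and> n \<le> k) \<and> ?L t m n c d"
    then obtain t m n where *: "phi (f (pair i j)) t m" "int n \<le> int_decode (left m)" "?L t m n c d"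
      unfolding int_decode_ge_iff by blast
    have "real n / Suc (right m) \<le> real_of_rat (rat_enum m)"
      unfolding rat_enum_eq using *(2) by (intro divide_right_mono) linarith+
    with f(3)[OF *(1)] *(3) show "radius c + radius d < dist (s i) (s j)"
      unfolding radius_def by simp
  next
    assume "radius c + radius d < dist (s i) (s j)"
    then obtain t where "1 / 2 ^ t < (dist (s i) (s j) - radius c - radius d) / 2"
      using inverse_two_power_less[of "(dist (s i) (s j) - radius c - radius d) / 2"] by auto
    moreover define e :: real where "e = 1 / 2 ^ t"
    ultimately have t: "2 * e < dist (s i) (s j) - radius c - radius d" by simp
    obtain m where m: "phi (f (pair i j)) t m" using f(2) by blast
    define n where "n = nat (int_decode (left m))"
    \<comment> \<open>The gap forces the approximation to be positive, so its numerator itself can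
      serve as \<open>n\<close>.\<close>
    have pos: "real_of_rat (rat_enum m) > 0"
      using f(3)[OF m, folded e_def] t radius_pos[of c] radius_pos[of d] by linarith
    then have ge: "int_decode (left m) \<ge> 0" unfolding rat_enum_eq by (simp add: zero_less_divide_iff)
    then have "real n / Suc (right m) = real_of_rat (rat_enum m)"
      unfolding rat_enum_eq n_def by (simp add: of_nat_nat)
    with f(3)[OF m, folded e_def] t have "radius c + e + radius d < real n / Suc (right m)" by linarith
    then have "?L t m n c d" unfolding radius_def e_def by simp
    moreover have "int n \<le> int_decode (left m)" unfolding n_def using ge by simp
    ultimately show "\<exists>t m n. phi (f (pair i j)) t m \<and>
      (\<exists>k. left m = 2 * k \<and> n \<le> k) \<and> ?L t m n c d"
      using m unfolding int_decode_ge_iff by blast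
  qed
  ultimately show ?thesis by simp
qed

text \<open>Formal inclusion: a condition on centres and radii that implies inclusion of the balls
  and is enumerable by \<open>re_dist_less\<close>.\<close>

definition subball :: "nat \<Rightarrow> nat \<Rightarrow> bool" where
  "subball k i \<longleftrightarrow> dist (s (left k)) (s (left i)) + radius (right k) < radius (right i)"

text \<open>Formal disjointness: it places ball \<open>k\<close> outside the closed ball belonging
  to \<open>i\<close>.\<close>

definition apart :: "nat \<Rightarrow> nat \<Rightarrow> bool" where
  "apart k i \<longleftrightarrow> radius (right k) + radius (right i) < dist (s (left k)) (s (left i))"

text \<open>Every point of the intersection has a small ideal ball around it that is formally
  included in both balls. This makes intersections of first-level sets effective.\<close>

lemma ideal_ball_Int:
  "ideal_ball s i \<inter> ideal_ball s j = (\<Union>k\<in>{k. subball k i \<and> subball k j}. ideal_ball s k)"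
proof (intro equalityI subsetI)
  fix x assume "x \<in> ideal_ball s i \<inter> ideal_ball s j"
  then have x: "dist x (s (left i)) < radius (right i)" "dist x (s (left j)) < radius (right j)"
    by (auto simp: ideal_ball_eq)
  \<comment> \<open>\<open>e\<close> is the smaller slack at \<open>x\<close>. It is halved since
    the new radius enters twice: as a radius, and as a bound for the distance from \<open>x\<close>
    to the new centre.\<close>
  define e where "e = min (radius (right i) - dist x (s (left i))) (radius (right j) - dist x (s (left j)))"
  have "e / 2 > 0" using x by (simp add: e_def)
  then obtain l where l: "radius l < e / 2" using radius_between[of 0 "e / 2"] by auto
  obtain k where k: "dist x (s k) < radius l" using dense_point[OF radius_pos] by blast
  have "dist (s k) (s (left i)) \<le> dist x (s k) + dist x (s (left i))"
    "dist (s k) (s (left j)) \<le> dist x (s k) + dist x (s (left j))"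
    by (metis dist_commute dist_triangle)+
  then have "subball (pair k l) i" "subball (pair k l) j"
    using k l unfolding subball_def e_def by auto
  moreover have "x \<in> ideal_ball s (pair k l)" using k by (simp add: ideal_ball_eq)
  ultimately show "x \<in> (\<Union>k\<in>{k. subball k i \<and> subball k j}. ideal_ball s k)" by blast
next
  fix x assume "x \<in> (\<Union>k\<in>{k. subball k i \<and> subball k j}. ideal_ball s k)"
  then obtain k where k: "subball k i" "subball k j" "dist x (s (left k)) < radius (right k)"
    by (auto simp: ideal_ball_eq)
  have "dist x (s (left i)) \<le> dist x (s (left k)) + dist (s (left k)) (s (left i))"
    "dist x (s (left j)) \<le> dist x (s (left k)) + dist (s (left k)) (s (left j))"
    by (rule dist_triangle)+
  with k show "x \<in> ideal_ball s i \<inter> ideal_ball s j"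
    unfolding subball_def by (auto simp: ideal_ball_eq)
qed

lemma ball_exterior:
  "{x. dist x (s (left i)) > radius (right i)} = (\<Union>k\<in>{k. apart k i}. ideal_ball s k)"
proof (intro equalityI subsetI)
  fix x assume "x \<in> {x. dist x (s (left i)) > radius (right i)}"
  then have "0 < (dist x (s (left i)) - radius (right i)) / 2" by simp
  then obtain l where l: "radius l < (dist x (s (left i)) - radius (right i)) / 2"
    using radius_between[OF order_refl] by blast
  obtain k where k: "dist x (s k) < radius l" using dense_point[OF radius_pos] by blast
  have "dist x (s (left i)) \<le> dist x (s k) + dist (s k) (s (left i))" by (rule dist_triangle)
  with k l have "apart (pair k l) i" unfolding apart_def by simp
  moreover have "x \<in> ideal_ball s (pair k l)" using k by (simp add: ideal_ball_eq)
  ultimately show "x \<in> (\<Union>k\<in>{k. apart k i}. ideal_ball s k)" by blast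
next
  fix x assume "x \<in> (\<Union>k\<in>{k. apart k i}. ideal_ball s k)"
  then obtain k where k: "apart k i" "dist x (s (left k)) < radius (right k)"
    by (auto simp: ideal_ball_eq)
  have "dist (s (left k)) (s (left i)) \<le> dist x (s (left k)) + dist x (s (left i))"
    by (metis dist_commute dist_triangle)
  with k show "x \<in> {x. dist x (s (left i)) > radius (right i)}" unfolding apart_def by simp
qed

text \<open>An open ball is exhausted by closed balls of smaller rational radii. Their complements
  are effectively open by \<open>ball_exterior\<close>, so this places ideal balls on the second
  level.\<close>

lemma ideal_ball_interior:
  "ideal_ball s i = (\<Union>j\<in>{j. radius j < radius (right i)}. - {x. dist x (s (left i)) > radius j})"
proof (intro equalityI subsetI)
  fix x assume "x \<in> ideal_ball s i"
  then have "dist x (s (left i)) < radius (right i)" by (simp add: ideal_ball_eq)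
  from radius_between[OF zero_le_dist this]
  show "x \<in> (\<Union>j\<in>{j. radius j < radius (right i)}. - {x. dist x (s (left i)) > radius j})"
    by (auto simp: not_less intro: less_imp_le)
qed (auto simp: ideal_ball_eq)

lemma UN_ideal_ball: "(\<Union>k. ideal_ball s k) = UNIV"
proof -
  have "x \<in> (\<Union>k. ideal_ball s k)" for x
  proof -
    obtain k where "dist x (s k) < radius 0" using dense_point[OF radius_pos] by blast
    then have "x \<in> ideal_ball s (pair k 0)" by (simp add: ideal_ball_eq)
    then show ?thesis by blast
  qed
  then show ?thesis by blast
qed

text \<open>Levels are shifted by one: \<open>uniformly_Sigma D n\<close> speaks about \<open>\<Sigma>\<^sup>0\<close> sets of level \<open>n + 1\<close> in \<open>D\<close>.\<close>

definition uniformly_Sigma :: "'a set \<Rightarrow> nat \<Rightarrow> (nat \<Rightarrow> 'a set) \<Rightarrow> bool" where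
  "uniformly_Sigma D n S \<longleftrightarrow>
     (\<exists>f. computable f \<and> (\<forall>j. Sigma_in_index s (Suc n) D (f j) (D \<inter> S j)))"

lemma uniformly_Sigma_iff:
  "uniformly_Sigma D n S \<longleftrightarrow>
     (\<exists>f. computable f \<and> (\<forall>j. \<forall>x\<in>D. x \<in> S j \<longleftrightarrow> x \<in> sigma_set s (Suc n) (f j)))"
  unfolding uniformly_Sigma_def Sigma_in_index_def by (intro ex_cong1 conj_cong refl) auto

text \<open>These are the building blocks of level \<open>n + 1\<close>. By
  \<open>sigma_set_base\<close> the sets of that level are the c.e. unions of them, which removes
  the case distinction between the first level and the later ones.\<close>

fun base :: "nat \<Rightarrow> nat \<Rightarrow> 'a set" where
  "base 0 i = ideal_ball s i"
| "base (Suc n) i = - sigma_set s (Suc n) i"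

lemma sigma_set_base: "sigma_set s (Suc n) e = (\<Union>i\<in>W e. base n i)"
  by (cases n) auto

lemma uniformly_Sigma_cong: "uniformly_Sigma D n S \<Longrightarrow> (\<And>j x. x \<in> D \<Longrightarrow> x \<in> S j \<longleftrightarrow> x \<in> S' j) \<Longrightarrow> uniformly_Sigma D n S'"
  unfolding uniformly_Sigma_iff by (metis (no_types, lifting))

lemma uniformly_Sigma_mono: "uniformly_Sigma UNIV n S \<Longrightarrow> uniformly_Sigma D n S"
  unfolding uniformly_Sigma_iff by blast

lemma uniformly_Sigma_sigma_set: "uniformly_Sigma D n (sigma_set s (Suc n))"
  unfolding uniformly_Sigma_iff using computable_id by blast

lemma uniformly_Sigma_comp: "uniformly_Sigma D n S \<Longrightarrow> computable g \<Longrightarrow> uniformly_Sigma D n (\<lambda>j. S (g j))"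
  unfolding uniformly_Sigma_iff by (auto dest: computable_comp)

text \<open>\<open>smn\<close> converts an enumerable relation between \<open>j\<close> and building
  blocks into a computable function giving indices.\<close>

lemma uniformly_Sigma_index:
  assumes "re (\<lambda>z. right z \<in> I (left z))" "\<And>j x. x \<in> D \<Longrightarrow> x \<in> S j \<longleftrightarrow> x \<in> (\<Union>i\<in>I j. base n i)"
  shows "uniformly_Sigma D n S"
proof -
  obtain g where g: "computable g" "\<And>j. W (g j) = {x. x \<in> I j}"
    using smn[where R = "\<lambda>j x. x \<in> I j", OF assms(1)] by blast
  show ?thesis unfolding uniformly_Sigma_iff sigma_set_base
    by (intro exI[of _ g] conjI g(1) allI ballI) (simp only: assms(2) g(2) Collect_mem_eq)
qed

lemma uniformly_Sigma_base: "uniformly_Sigma D n (base n)"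
  by (rule uniformly_Sigma_index[of "\<lambda>j. {j}"])
    (auto intro!: re_decidable decidable_eq computable_intros)

lemma uniformly_Sigma_Union:
  assumes "uniformly_Sigma D n S" "re (\<lambda>z. R (left z) (right z))"
  shows "uniformly_Sigma D n (\<lambda>j. \<Union>k\<in>{k. R j k}. S k)"
proof -
  from assms(1) obtain f where f: "computable f"
      "\<And>j x. x \<in> D \<Longrightarrow> x \<in> S j \<longleftrightarrow> x \<in> (\<Union>i\<in>W (f j). base n i)"
    unfolding uniformly_Sigma_iff sigma_set_base by blast
  have R: "re (\<lambda>z. R (f z) (g z))" if "computable f" "computable g" for f g
    using re_comp[OF assms(2), of "\<lambda>z. pair (f z) (g z)"] that
    by (simp add: computable_basic)
  have "re (\<lambda>z. right z \<in> {i. \<exists>k. R (left z) k \<and> i \<in> W (f k)})"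
    unfolding mem_Collect_eq
    by (intro re_intros R re_W computable_comp[OF f(1)] computable_intros)
  then show ?thesis by (rule uniformly_Sigma_index) (auto simp: f(2))
qed

lemma uniformly_Sigma_UN:
  assumes "uniformly_Sigma D n (\<lambda>z. S (left z) (right z))" "re (\<lambda>z. R (left z) (right z))"
  shows "uniformly_Sigma D n (\<lambda>j. \<Union>k\<in>{k. R j k}. S j k)"
proof -
  have R: "re (\<lambda>z. R (f z) (g z))" if "computable f" "computable g" for f g
    using re_comp[OF assms(2), of "\<lambda>z. pair (f z) (g z)"] that
    by (simp add: computable_basic)
  \<comment> \<open>The family is indexed by pairs, and the union for \<open>j\<close> runs only
    over pairs whose first component is \<open>j\<close>.\<close>
  have "re (\<lambda>z. left (right z) = left z \<and> R (left z) (right (right z)))"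
    by (intro re_intros R re_decidable decidable_eq computable_intros)
  from uniformly_Sigma_Union[OF assms(1) this] show ?thesis
    by (rule uniformly_Sigma_cong) (auto intro: exI[of _ "pair _ _"])
qed

lemma uniformly_Sigma_Un:
  assumes "uniformly_Sigma D n S" "uniformly_Sigma D n S'"
  shows "uniformly_Sigma D n (\<lambda>j. S j \<union> S' j)"
proof -
  from assms obtain f f' where f: "computable f" "computable f'"
      "\<And>j x. x \<in> D \<Longrightarrow> x \<in> S j \<longleftrightarrow> x \<in> (\<Union>i\<in>W (f j). base n i)"
      "\<And>j x. x \<in> D \<Longrightarrow> x \<in> S' j \<longleftrightarrow> x \<in> (\<Union>i\<in>W (f' j). base n i)"
    unfolding uniformly_Sigma_iff sigma_set_base by metis
  have "re (\<lambda>z. right z \<in> W (f (left z)) \<union> W (f' (left z)))"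
    unfolding Un_iff
    by (intro re_intros re_W computable_comp[OF f(1)] computable_comp[OF f(2)] computable_intros)
  then show ?thesis by (rule uniformly_Sigma_index) (auto simp: f(3,4))
qed

lemma uniformly_Sigma_Compl: "uniformly_Sigma D n S \<Longrightarrow> uniformly_Sigma D (Suc n) (\<lambda>j. - S j)"
proof -
  assume "uniformly_Sigma D n S"
  then obtain f where f: "computable f"
      "\<And>j x. x \<in> D \<Longrightarrow> x \<in> S j \<longleftrightarrow> x \<in> sigma_set s (Suc n) (f j)"
    unfolding uniformly_Sigma_iff by blast
  show ?thesis
    by (rule uniformly_Sigma_cong[OF uniformly_Sigma_comp[OF uniformly_Sigma_base[of D "Suc n"] f(1)]]) (simp add: f(2))
qed

text \<open>On the first level this is formal inclusion of balls; above it, De Morgan reduces the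
  claim to unions one level below. Arbitrary intersections then follow by distributing over the
  unions of building blocks.\<close>

lemma uniformly_Sigma_base_Int: "uniformly_Sigma D n (\<lambda>z. base n (left z) \<inter> base n (right z))"
proof (cases n)
  case 0
  have "re (\<lambda>z. subball (right z) (left (left z)) \<and> subball (right z) (right (left z)))"
    unfolding subball_def by (intro re_intros re_dist_less computable_intros)
  from uniformly_Sigma_Union[OF uniformly_Sigma_base[of D 0] this] show ?thesis
    unfolding 0 by (rule uniformly_Sigma_cong) (simp only: base.simps ideal_ball_Int)
next
  case (Suc m)
  have "uniformly_Sigma D (Suc m) (\<lambda>z. - (sigma_set s (Suc m) (left z) \<union> sigma_set s (Suc m) (right z)))"
    by (intro uniformly_Sigma_Compl uniformly_Sigma_Un uniformly_Sigma_comp[OF uniformly_Sigma_sigma_set] computable_intros)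
  then show ?thesis unfolding Suc base.simps Compl_Un .
qed

lemma uniformly_Sigma_Int:
  assumes "uniformly_Sigma D n S" "uniformly_Sigma D n S'"
  shows "uniformly_Sigma D n (\<lambda>j. S j \<inter> S' j)"
proof -
  from assms obtain f f' where f: "computable f" "computable f'"
      "\<And>j x. x \<in> D \<Longrightarrow> x \<in> S j \<longleftrightarrow> x \<in> (\<Union>i\<in>W (f j). base n i)"
      "\<And>j x. x \<in> D \<Longrightarrow> x \<in> S' j \<longleftrightarrow> x \<in> (\<Union>i\<in>W (f' j). base n i)"
    unfolding uniformly_Sigma_iff sigma_set_base by metis
  have "re (\<lambda>z. left (right z) \<in> W (f (left z)) \<and> right (right z) \<in> W (f' (left z)))"
    by (intro re_intros re_W computable_comp[OF f(1)] computable_comp[OF f(2)] computable_intros)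
  from uniformly_Sigma_Union[OF uniformly_Sigma_base_Int this] show ?thesis
    by (rule uniformly_Sigma_cong) (fastforce simp: f(3,4) intro: exI[of _ "pair _ _"])
qed

text \<open>This gives the inclusion of each level in the next. For ideal balls it is the exhaustion
  by closed balls; the induction step passes from building blocks to their unions and then to
  complements.\<close>

lemma uniformly_Sigma_base_Suc: "uniformly_Sigma D (Suc n) (base n)"
proof (induction n)
  case 0
  have "re (\<lambda>z. apart (right z) (left z))"
    unfolding apart_def by (intro re_dist_greater computable_intros)
  from uniformly_Sigma_Union[OF uniformly_Sigma_base[of D 0] this]
  have ext: "uniformly_Sigma D 0 (\<lambda>i. {x. dist x (s (left i)) > radius (right i)})"
    by (rule uniformly_Sigma_cong) (simp only: base.simps ball_exterior)
  have "uniformly_Sigma D (Suc 0) (\<lambda>z. - {x. dist x (s (left (left z))) > radius (right z)})"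
    using uniformly_Sigma_Compl[OF uniformly_Sigma_comp[OF ext, of "\<lambda>z. pair (left (left z)) (right z)"]]
    by (simp add: computable_intros)
  moreover have "re (\<lambda>z. radius (right z) < radius (right (left z)))"
  proof -
    have *: "radius i < radius j \<longleftrightarrow>
        Suc (left i) * Suc (right j) < Suc (left j) * Suc (right i)" for i j
      unfolding radius_def by (subst divide_less_divide_iff) (simp_all only: of_nat_0_less_iff zero_less_Suc of_nat_less_iff flip: of_nat_mult)
    show ?thesis unfolding *
      by (intro re_decidable decidable_less computable_intros)
  qed
  ultimately have "uniformly_Sigma D (Suc 0) (\<lambda>i. \<Union>j\<in>{j. radius j < radius (right i)}.
      - {x. dist x (s (left i)) > radius j})"
    by (rule uniformly_Sigma_UN)
  then show ?case
    by (rule uniformly_Sigma_cong) (simp only: base.simps ideal_ball_interior[symmetric])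
next
  case (Suc n)
  have "uniformly_Sigma D (Suc n) (\<lambda>e. \<Union>i\<in>{i. i \<in> W e}. base n i)"
    by (rule uniformly_Sigma_Union[OF Suc]) (intro re_W computable_intros)
  then have "uniformly_Sigma D (Suc n) (sigma_set s (Suc n))"
    by (rule uniformly_Sigma_cong) (simp add: sigma_set_base)
  from uniformly_Sigma_Compl[OF this] show ?case by (rule uniformly_Sigma_cong) simp
qed

lemma uniformly_Sigma_Suc: "uniformly_Sigma D n S \<Longrightarrow> uniformly_Sigma D (Suc n) S"
proof -
  assume "uniformly_Sigma D n S"
  then obtain f where f: "computable f"
      "\<And>j x. x \<in> D \<Longrightarrow> x \<in> S j \<longleftrightarrow> x \<in> (\<Union>i\<in>W (f j). base n i)"
    unfolding uniformly_Sigma_iff sigma_set_base by metis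
  have "uniformly_Sigma D (Suc n) (\<lambda>j. \<Union>i\<in>{i. i \<in> W (f j)}. base n i)"
    by (rule uniformly_Sigma_Union[OF uniformly_Sigma_base_Suc]) (intro re_W computable_comp[OF f(1)] computable_intros)
  then show ?thesis by (rule uniformly_Sigma_cong) (auto simp: f(2))
qed

lemma uniformly_Sigma_if:
  assumes "decidable P" "uniformly_Sigma D n S" "uniformly_Sigma D n S'"
  shows "uniformly_Sigma D n (\<lambda>j. if P j then S j else S' j)"
proof -
  from assms(2,3) obtain f f' where f: "computable f" "computable f'"
      "\<And>j x. x \<in> D \<Longrightarrow> x \<in> S j \<longleftrightarrow> x \<in> sigma_set s (Suc n) (f j)"
      "\<And>j x. x \<in> D \<Longrightarrow> x \<in> S' j \<longleftrightarrow> x \<in> sigma_set s (Suc n) (f' j)"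
    unfolding uniformly_Sigma_iff by metis
  show ?thesis unfolding uniformly_Sigma_iff
    by (intro exI[of _ "\<lambda>j. if P j then f j else f' j"])
      (auto intro: computable_if assms(1) f(1,2) simp: f(3,4) simp del: sigma_set.simps)
qed

lemma uniformly_Sigma_UNIV: "uniformly_Sigma D n (\<lambda>j. UNIV)"
proof (cases n)
  case 0
  have "uniformly_Sigma D 0 (\<lambda>j. \<Union>k\<in>{k. True}. base 0 k)"
    by (rule uniformly_Sigma_Union[OF uniformly_Sigma_base]) (rule re_decidable, simp add: decidable_def computable_const)
  then show ?thesis unfolding 0 by (rule uniformly_Sigma_cong) (use UN_ideal_ball in auto)
next
  case (Suc m)
  have "uniformly_Sigma D m (\<lambda>j. \<Union>k\<in>{k. False}. base m k)"
    by (rule uniformly_Sigma_Union[OF uniformly_Sigma_base]) (rule re_decidable, simp add: decidable_def computable_const)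
  from uniformly_Sigma_Compl[OF this] show ?thesis unfolding Suc by simp
qed

text \<open>The number of sets depends on \<open>j\<close>, so the binary case has to be iterated on
  indices: \<open>c\<close> computes an index of an intersection, and primitive recursion applies it
  \<open>h j\<close> times, starting from an index of the whole space.\<close>

lemma uniformly_Sigma_INT:
  assumes "uniformly_Sigma D n (\<lambda>z. S (left z) (right z))" "computable h"
  shows "uniformly_Sigma D n (\<lambda>j. \<Inter>k<h j. S j k)"
proof -
  from assms(1) obtain f where f: "computable f"
      "\<And>z x. x \<in> D \<Longrightarrow> x \<in> S (left z) (right z) \<longleftrightarrow> x \<in> sigma_set s (Suc n) (f z)"
    unfolding uniformly_Sigma_iff by blast
  from uniformly_Sigma_UNIV[of D n] obtain u where u: "computable u"
      "\<And>j x. x \<in> D \<Longrightarrow> x \<in> sigma_set s (Suc n) (u j)"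
    unfolding uniformly_Sigma_iff by blast
  have "uniformly_Sigma D n (\<lambda>z. sigma_set s (Suc n) (left z) \<inter> sigma_set s (Suc n) (right z))"
    by (intro uniformly_Sigma_Int uniformly_Sigma_comp[OF uniformly_Sigma_sigma_set] computable_intros)
  then obtain c where c: "computable c" "\<And>z x. x \<in> D \<Longrightarrow>
      x \<in> sigma_set s (Suc n) (left z) \<inter> sigma_set s (Suc n) (right z) \<longleftrightarrow>
      x \<in> sigma_set s (Suc n) (c z)"
    unfolding uniformly_Sigma_iff by blast
  define r where "r j m = rec_nat (u j) (\<lambda>m y. c (pair (f (pair j m)) y)) m" for j m
  have "computable (\<lambda>j. r j (h j))"
    unfolding r_def
    by (intro computable_rec assms(2) u(1) computable_comp[OF c(1)] computable_comp[OF f(1)] computable_basic)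
  moreover have "x \<in> (\<Inter>k<m. S j k) \<longleftrightarrow> x \<in> sigma_set s (Suc n) (r j m)" if "x \<in> D" for x j m
  proof (induction m)
    case 0 then show ?case using u(2)[OF that] by (simp add: r_def del: sigma_set.simps)
  next
    case (Suc m)
    have "r j (Suc m) = c (pair (f (pair j m)) (r j m))" by (simp add: r_def)
    then show ?case
      using Suc c(2)[OF that, of "pair (f (pair j m)) (r j m)"] f(2)[OF that, of "pair j m"]
      by (auto simp del: sigma_set.simps simp: less_Suc_eq)
  qed
  ultimately show ?thesis unfolding uniformly_Sigma_iff by blast
qed

section \<open>Preimages under iterates and effective visit counts\<close>

context
  fixes D :: "'a set" and T :: "'a \<Rightarrow> 'a"
  assumes T_D: "\<And>x. x \<in> D \<Longrightarrow> T x \<in> D"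
    and uniformly_Sigma_T: "uniformly_Sigma D 0 (\<lambda>i. T -` ideal_ball s i)"
begin

text \<open>Preimages commute with unions and complements, so the hypothesis on ideal balls
  propagates through all levels.\<close>

lemma uniformly_Sigma_vimage_sigma_set: "uniformly_Sigma D n (\<lambda>e. T -` sigma_set s (Suc n) e)"
proof -
  have "uniformly_Sigma D n (\<lambda>i. T -` base n i) \<Longrightarrow> uniformly_Sigma D n (\<lambda>e. T -` sigma_set s (Suc n) e)" for n
  proof -
    assume "uniformly_Sigma D n (\<lambda>i. T -` base n i)"
    then have "uniformly_Sigma D n (\<lambda>e. \<Union>i\<in>{i. i \<in> W e}. T -` base n i)"
      by (rule uniformly_Sigma_Union) (intro re_W computable_intros)
    then show "uniformly_Sigma D n (\<lambda>e. T -` sigma_set s (Suc n) e)"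
      by (rule uniformly_Sigma_cong) (simp add: sigma_set_base)
  qed
  moreover have "uniformly_Sigma D n (\<lambda>i. T -` base n i)" for n
  proof (induction n)
    case 0 then show ?case using uniformly_Sigma_T by simp
  next
    case (Suc n)
    from uniformly_Sigma_Compl[OF calculation[OF this]] show ?case by (rule uniformly_Sigma_cong) simp
  qed
  ultimately show ?thesis by blast
qed

text \<open>The index transformation \<open>h\<close> for one preimage is iterated \<open>k\<close>
  times. It is correct only at points of \<open>D\<close>, and \<open>T_D\<close> keeps the orbit
  there.\<close>

lemma uniformly_Sigma_vimage_funpow:
  assumes "uniformly_Sigma D n S" shows "uniformly_Sigma D n (\<lambda>z. (T ^^ left z) -` S (right z))"
proof -
  from assms obtain f where f: "computable f"
      "\<And>j x. x \<in> D \<Longrightarrow> x \<in> S j \<longleftrightarrow> x \<in> sigma_set s (Suc n) (f j)"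
    unfolding uniformly_Sigma_iff by blast
  from uniformly_Sigma_vimage_sigma_set[of n] obtain h where h: "computable h"
      "\<And>e x. x \<in> D \<Longrightarrow> T x \<in> sigma_set s (Suc n) e \<longleftrightarrow> x \<in> sigma_set s (Suc n) (h e)"
    unfolding uniformly_Sigma_iff vimage_eq by blast
  define r where "r j k = rec_nat (f j) (\<lambda>_. h) k" for j k
  have "computable (\<lambda>z. r (right z) (left z))"
    unfolding r_def by (intro computable_rec computable_comp[OF f(1)] computable_comp[OF h(1)] computable_basic)
  moreover have "(T ^^ k) x \<in> S j \<longleftrightarrow> x \<in> sigma_set s (Suc n) (r j k)" if "x \<in> D" for x j k
    using that
  proof (induction k arbitrary: x)
    case 0 then show ?case by (simp add: r_def f(2) del: sigma_set.simps)
  next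
    case (Suc k)
    have "(T ^^ Suc k) x = (T ^^ k) (T x)" by (simp add: funpow_swap1)
    moreover have "r j (Suc k) = h (r j k)" by (simp add: r_def)
    ultimately show ?case using Suc.IH[OF T_D[OF Suc.prems]] h(2)[OF Suc.prems] by metis
  qed
  ultimately show ?thesis unfolding uniformly_Sigma_iff vimage_eq by blast
qed

text \<open>A lower bound on the number of visits is positive information: some sufficiently large
  set of times consists of visits only. The code \<open>c\<close> represents the times with nonzero
  entry, so the set is a c.e. union of finite intersections of preimages.\<close>

lemma uniformly_Sigma_hits:
  assumes "uniformly_Sigma D n S" "computable a" "computable b" "computable l" "computable r"
  shows "uniformly_Sigma D n (\<lambda>z. {x. l z < r z * hits T (S (a z)) (b z) x})"
proof -
  let ?card = "\<lambda>c m. card {k \<in> {..<m}. entry c k \<noteq> 0}"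
  let ?S = "\<lambda>z c k. if entry c k = 0 then UNIV else (T ^^ k) -` S (a z)"
  let ?U = "\<lambda>z. \<Union>c\<in>{c. l z < r z * ?card c (b z)}. \<Inter>k<b z. ?S z c k"
  \<comment> \<open>As a recursion, the cardinality is seen to be computable in \<open>c\<close> and
    \<open>m\<close>.\<close>
  have card_rec: "?card c m = rec_nat 0 (\<lambda>k y. if entry c k = 0 then y else Suc y) m" for c m
  proof (induction m)
    case (Suc m)
    have "{k \<in> {..<Suc m}. entry c k \<noteq> 0} =
        (if entry c m = 0 then {} else {m}) \<union> {k \<in> {..<m}. entry c k \<noteq> 0}"
      by (auto simp: less_Suc_eq)
    with Suc show ?case by simp
  qed simp
  note comp = assms(2-)[THEN computable_comp]
  have "uniformly_Sigma D n ?U"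
  proof (rule uniformly_Sigma_UN)
    have "uniformly_Sigma D n (\<lambda>w. \<Inter>k<b (left w). ?S (left w) (right w) k)"
    proof (rule uniformly_Sigma_INT)
      have "uniformly_Sigma D n (\<lambda>w. (T ^^ right w) -` S (a (left (left w))))"
        using uniformly_Sigma_comp[OF uniformly_Sigma_vimage_funpow[OF assms(1)], of "\<lambda>w. pair (right w) (a (left (left w)))"]
        by (simp add: computable_intros comp)
      then show "uniformly_Sigma D n (\<lambda>w. ?S (left (left w)) (right (left w)) (right w))"
        by (intro uniformly_Sigma_if uniformly_Sigma_UNIV decidable_eq computable_intros)
    qed (intro comp computable_intros)
    then show "uniformly_Sigma D n (\<lambda>w. \<Inter>k<b (left w). ?S (left w) (right w) k)" .
    show "re (\<lambda>w. l (left w) < r (left w) * ?card (right w) (b (left w)))"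
      unfolding card_rec
      by (intro re_decidable decidable_less computable_rec computable_if decidable_eq comp computable_intros)
  qed
  then show ?thesis
  proof (rule uniformly_Sigma_cong)
    fix z x
    have "x \<in> ?U z \<longleftrightarrow> l z < r z * hits T (S (a z)) (b z) x"
    proof
      assume "x \<in> ?U z"
      then obtain c where c: "l z < r z * ?card c (b z)" "\<And>k. k < b z \<Longrightarrow> x \<in> ?S z c k" by blast
      have "?card c (b z) \<le> hits T (S (a z)) (b z) x"
      proof -
        have "(T ^^ k) x \<in> S (a z)" if "k < b z" "entry c k \<noteq> 0" for k
          using c(2)[OF that(1)] that(2) by simp
        then show ?thesis unfolding hits_def by (intro card_mono) auto
      qed
      from less_le_trans[OF c(1) mult_le_mono2[OF this]]
      show "l z < r z * hits T (S (a z)) (b z) x" .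
    next
      assume *: "l z < r z * hits T (S (a z)) (b z) x"
      obtain c where c: "\<forall>k<b z. entry c k = of_bool ((T ^^ k) x \<in> S (a z))"
        using entry_exists[of "b z" "\<lambda>k. of_bool ((T ^^ k) x \<in> S (a z))"] by blast
      then have "{k \<in> {..<b z}. entry c k \<noteq> 0} = {k \<in> {..<b z}. (T ^^ k) x \<in> S (a z)}" by auto
      with * have "l z < r z * ?card c (b z)" unfolding hits_def by simp
      moreover have "x \<in> (\<Inter>k<b z. ?S z c k)" using c by auto
      ultimately show "x \<in> ?U z" by blast
    qed
    then show "x \<in> ?U z \<longleftrightarrow> x \<in> {x. l z < r z * hits T (S (a z)) (b z) x}" by simp
  qed
qed

end

end

section \<open>Birkhoff sums\<close>

definition birkhoff_sum :: "('a \<Rightarrow> 'a) \<Rightarrow> ('a \<Rightarrow> real) \<Rightarrow> nat \<Rightarrow> 'a \<Rightarrow> real" where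
  "birkhoff_sum T f N x = (\<Sum>k<N. f ((T ^^ k) x))"

lemma birkhoff_sum_Suc_shift: "birkhoff_sum T f (Suc N) x = f x + birkhoff_sum T f N (T x)"
  unfolding birkhoff_sum_def by (subst sum.lessThan_Suc_shift) (simp add: funpow_swap1)

lemma birkhoff_sum_0: "birkhoff_sum T f 0 x = 0"
  by (simp add: birkhoff_sum_def)

section \<open>The maximal ergodic theorem\<close>

locale mpt = prob_space M for M :: "'a measure" +
  fixes T :: "'a \<Rightarrow> 'a"
  assumes measurable_T[measurable]: "T \<in> measurable M M"
    and distr_T: "distr M M T = M"
begin

lemma measurable_funpow[measurable]: "T ^^ k \<in> measurable M M"
  by (induction k) (auto simp: id_def)

lemma measurable_birkhoff_sum[measurable]:
  "f \<in> borel_measurable M \<Longrightarrow> birkhoff_sum T f N \<in> borel_measurable M"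
  unfolding birkhoff_sum_def[abs_def]
  by (intro borel_measurable_sum measurable_compose[OF measurable_funpow])

lemma integrable_T: "integrable M f \<Longrightarrow> integrable M (\<lambda>x. f (T x))"
  for f :: "'a \<Rightarrow> real"
  using integrable_distr_eq[of T M M f] distr_T by (metis borel_measurable_integrable measurable_T)

lemma integral_T: "f \<in> borel_measurable M \<Longrightarrow> (\<integral>x. f (T x) \<partial>M) = (\<integral>x. f x \<partial>M)"
  for f :: "'a \<Rightarrow> real"
  using integral_distr[of T M M f] distr_T by simp

lemma integrable_birkhoff_sum:
  assumes "integrable M f" shows "integrable M (birkhoff_sum T f N)"
proof -
  have "integrable M (\<lambda>x. f ((T ^^ k) x))" for k
  proof (induction k)
    case (Suc k)
    from integrable_T[OF this] show ?case by (simp add: funpow_swap1)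
  qed (simp add: assms)
  then show ?thesis unfolding birkhoff_sum_def[abs_def] by simp
qed

primrec max_birkhoff_sum :: "('a \<Rightarrow> real) \<Rightarrow> nat \<Rightarrow> 'a \<Rightarrow> real" where
  "max_birkhoff_sum f 0 x = 0"
| "max_birkhoff_sum f (Suc N) x = max (max_birkhoff_sum f N x) (birkhoff_sum T f (Suc N) x)"

lemma max_birkhoff_sum_ge: "k \<le> N \<Longrightarrow> birkhoff_sum T f k x \<le> max_birkhoff_sum f N x"
  by (induction N) (auto simp: birkhoff_sum_0 le_Suc_eq)

lemma max_birkhoff_sum_nonneg: "0 \<le> max_birkhoff_sum f N x"
  by (induction N) auto

lemma max_birkhoff_sum_pos: "max_birkhoff_sum f N x > 0 \<longleftrightarrow> (\<exists>k\<le>N. birkhoff_sum T f k x > 0)"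
  by (induction N) (auto simp: birkhoff_sum_0 le_Suc_eq less_max_iff_disj)

text \<open>Each nonempty sum at \<open>x\<close> is \<open>f x\<close> plus a shorter sum at
  \<open>T x\<close>. The bound is proved with a separate \<open>M\<close>, so that the right-hand
  side stays fixed during the induction.\<close>

lemma max_birkhoff_sum_le: "max_birkhoff_sum f N x \<le> max 0 (f x + max_birkhoff_sum f N (T x))"
proof -
  have "max_birkhoff_sum f N x \<le> max 0 (f x + max_birkhoff_sum f M (T x))" if "N \<le> M" for M
    using that
  proof (induction N)
    case (Suc N)
    have "birkhoff_sum T f (Suc N) x \<le> f x + max_birkhoff_sum f M (T x)"
      unfolding birkhoff_sum_Suc_shift using max_birkhoff_sum_ge[of N M] Suc.prems by simp
    then show ?case using Suc by simp
  qed simp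
  then show ?thesis by simp
qed

lemma integrable_max_birkhoff_sum: "integrable M f \<Longrightarrow> integrable M (max_birkhoff_sum f N)"
proof (induction N)
  case (Suc N)
  have "max_birkhoff_sum f (Suc N) = (\<lambda>x. max (max_birkhoff_sum f N x) (birkhoff_sum T f (Suc N) x))" by auto
  then show ?case using Suc integrable_birkhoff_sum[of f] by simp
qed (simp add: max_birkhoff_sum.simps(1)[abs_def])

text \<open>Garsia's argument: where the maximum is positive, \<open>f\<close> is at least the
  maximum at \<open>x\<close> minus the maximum at \<open>T x\<close>; elsewhere this difference is
  at most 0. Its integral vanishes because \<open>T\<close> preserves the measure.\<close>

lemma maximal_finite:
  assumes "integrable M f"
  shows "0 \<le> (\<integral>x. indicator {x \<in> space M. max_birkhoff_sum f N x > 0} x * f x \<partial>M)"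
proof -
  note [measurable] = borel_measurable_integrable[OF assms]
    borel_measurable_integrable[OF integrable_max_birkhoff_sum[OF assms]]
  let ?E = "{x \<in> space M. max_birkhoff_sum f N x > 0}"
  have "(\<integral>x. max_birkhoff_sum f N x - max_birkhoff_sum f N (T x) \<partial>M) \<le> (\<integral>x. indicator ?E x * f x \<partial>M)"
  proof (rule integral_mono)
    show "integrable M (\<lambda>x. max_birkhoff_sum f N x - max_birkhoff_sum f N (T x))"
      using integrable_max_birkhoff_sum[OF assms] integrable_T by auto
    show "integrable M (\<lambda>x. indicator ?E x * f x)"
      using assms integrable_real_mult_indicator[of ?E M f] by (simp add: mult.commute)
    fix x assume "x \<in> space M"
    then show "max_birkhoff_sum f N x - max_birkhoff_sum f N (T x) \<le> indicator ?E x * f x"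
      using max_birkhoff_sum_le[of f N x] max_birkhoff_sum_nonneg[of f N "T x"] max_birkhoff_sum_nonneg[of f N x]
      by (auto simp: indicator_def max_def split: if_splits)
  qed
  moreover have "(\<integral>x. max_birkhoff_sum f N x - max_birkhoff_sum f N (T x) \<partial>M) = 0"
    using integrable_max_birkhoff_sum[OF assms] integrable_T[OF integrable_max_birkhoff_sum[OF assms]]
    by (simp add: integral_T)
  ultimately show ?thesis by simp
qed

text \<open>The sets of the finite version increase to the set in question, and dominated
  convergence passes to the limit.\<close>

lemma maximal_ergodic:
  assumes "integrable M f"
  shows "0 \<le> (\<integral>x. indicator {x \<in> space M. \<exists>N. birkhoff_sum T f N x > 0} x * f x \<partial>M)"
proof -
  note [measurable] = borel_measurable_integrable[OF assms]
    borel_measurable_integrable[OF integrable_max_birkhoff_sum[OF assms]]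
  let ?E = "\<lambda>N. {x \<in> space M. max_birkhoff_sum f N x > 0}"
  let ?F = "{x \<in> space M. \<exists>N. birkhoff_sum T f N x > 0}"
  have F: "?F = (\<Union>N. ?E N)" by (auto simp: max_birkhoff_sum_pos)
  have inc: "incseq ?E"
  proof (rule incseq_SucI)
    show "?E N \<subseteq> ?E (Suc N)" for N by auto
  qed
  have "(\<lambda>N. \<integral>x. indicator (?E N) x * f x \<partial>M) \<longlonglongrightarrow> (\<integral>x. indicator ?F x * f x \<partial>M)"
  proof (rule integral_dominated_convergence[where w = "\<lambda>x. \<bar>f x\<bar>"])
    show "AE x in M. (\<lambda>N. indicator (?E N) x * f x) \<longlonglongrightarrow> indicator ?F x * f x"
      unfolding F using LIMSEQ_indicator_incseq[OF inc]
      by (intro AE_I2 tendsto_mult tendsto_const) 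
    show "AE x in M. norm (indicator (?E N) x * f x) \<le> \<bar>f x\<bar>" for N
      by (auto simp: indicator_def)
  qed (use assms in auto)
  then show ?thesis
    by (rule LIMSEQ_le_const) (auto intro: maximal_finite[OF assms])
qed

lemma integrable_indicat[simp]: "B \<in> sets M \<Longrightarrow> integrable M (indicat_real B)"
  by (simp add: less_top[symmetric])

text \<open>On \<open>?E\<close> the integral of the indicator minus \<open>c\<close> is
  non-negative, so \<open>c\<close> times the measure of \<open>?E\<close> is at most the measure of
  \<open>B\<close>.\<close>

lemma maximal_inequality:
  assumes [measurable]: "B \<in> sets M" and "c > 0"
  shows "measure M {x \<in> space M. \<exists>N. birkhoff_sum T (\<lambda>x. indicator B x - c) N x > 0} \<le> measure M B / c"
    (is "measure M ?E \<le> _")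
proof -
  have int: "integrable M (\<lambda>x. indicat_real B x - c)"
    by (intro Bochner_Integration.integrable_diff) auto
  have "0 \<le> (\<integral>x. indicator ?E x * (indicat_real B x - c) \<partial>M)"
    by (rule maximal_ergodic[OF int])
  also have "\<dots> = (\<integral>x. indicat_real (?E \<inter> B) x - c * indicator ?E x \<partial>M)"
    by (intro Bochner_Integration.integral_cong) (auto simp: indicator_def)
  also have "\<dots> = measure M (?E \<inter> B) - c * measure M ?E"
    by (subst Bochner_Integration.integral_diff) auto
  also have "\<dots> \<le> measure M B - c * measure M ?E"
    by (simp add: finite_measure_mono)
  finally show ?thesis using \<open>c > 0\<close> by (simp add: field_simps)
qed

text \<open>Unlike the condition that the averages exceed a bound infinitely often, unboundedness of the
  sums is exactly invariant under \<open>T\<close>.\<close>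

definition unbounded_sums :: "('a \<Rightarrow> real) \<Rightarrow> 'a set" where
  "unbounded_sums f = {x \<in> space M. \<forall>K::nat. \<exists>N. birkhoff_sum T f N x > K}"

lemma sets_unbounded_sums[measurable]: "f \<in> borel_measurable M \<Longrightarrow> unbounded_sums f \<in> sets M"
  unfolding unbounded_sums_def by measurable

text \<open>Sums along the orbits of \<open>x\<close> and \<open>T x\<close> differ by
  \<open>f x\<close> after an index shift, so raising the threshold by a bound \<open>C\<close> of
  the absolute value of \<open>f x\<close> suffices in both directions.\<close>

lemma unbounded_sums_invariant:
  assumes "x \<in> space M"
  shows "T x \<in> unbounded_sums f \<longleftrightarrow> x \<in> unbounded_sums f"
proof -
  have Tx: "T x \<in> space M" using measurable_space[OF measurable_T assms] .
  obtain C :: nat where C: "\<bar>f x\<bar> \<le> C" using real_arch_simple by blast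
  have "\<exists>N. birkhoff_sum T f N x > K" if *: "\<forall>K::nat. \<exists>N. birkhoff_sum T f N (T x) > K" for K :: nat
  proof -
    from * obtain N where "birkhoff_sum T f N (T x) > (K + C :: nat)" by blast
    then have "birkhoff_sum T f (Suc N) x > K" using C by (simp add: birkhoff_sum_Suc_shift)
    then show ?thesis by blast
  qed
  moreover have "\<exists>N. birkhoff_sum T f N (T x) > K" if *: "\<forall>K::nat. \<exists>N. birkhoff_sum T f N x > K" for K :: nat
  proof -
    from * obtain N where N: "birkhoff_sum T f N x > (K + C :: nat)" by blast
    then obtain N' where "N = Suc N'" by (cases N) (auto simp: birkhoff_sum_0)
    with N have "birkhoff_sum T f N' (T x) > K" using C by (simp add: birkhoff_sum_Suc_shift)
    then show ?thesis by blast
  qed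
  ultimately show ?thesis using assms Tx unfolding unbounded_sums_def by blast
qed

text \<open>An orbit that starts in the invariant set \<open>E\<close> stays there, and one that
  starts outside never enters. The sums of \<open>?g\<close> are therefore those of \<open>f\<close>
  on \<open>E\<close> and 0 elsewhere, so \<open>E\<close> is exactly the set in the maximal ergodic
  theorem for \<open>?g\<close>.\<close>

lemma integral_invariant_nonneg:
  assumes f: "integrable M f" and E[measurable]: "E \<in> sets M"
    and inv: "\<And>x. x \<in> space M \<Longrightarrow> T x \<in> E \<longleftrightarrow> x \<in> E" and sub: "E \<subseteq> unbounded_sums f"
  shows "0 \<le> (\<integral>x. indicator E x * f x \<partial>M)"
proof -
  let ?g = "\<lambda>x. indicator E x * f x"
  have g: "integrable M ?g"
    using f integrable_real_mult_indicator[of E M f] by (simp add: mult.commute)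
  have T_space: "(T ^^ k) x \<in> space M" if "x \<in> space M" for k x
    using measurable_space[OF measurable_funpow that] .
  have iter: "(T ^^ k) x \<in> E \<longleftrightarrow> x \<in> E" if "x \<in> space M" for k x
    by (induction k) (auto simp: inv T_space that)
  have g_sum: "birkhoff_sum T ?g N x = indicator E x * birkhoff_sum T f N x" if "x \<in> space M" for N x
    unfolding birkhoff_sum_def using iter[OF that] by (auto simp: indicator_def)
  have "{x \<in> space M. \<exists>N. birkhoff_sum T ?g N x > 0} = E"
  proof (intro equalityI subsetI)
    fix x assume "x \<in> {x \<in> space M. \<exists>N. birkhoff_sum T ?g N x > 0}"
    then obtain N where "x \<in> space M" "birkhoff_sum T ?g N x > 0" by blast
    then show "x \<in> E" unfolding g_sum[OF \<open>x \<in> space M\<close>] by (cases "x \<in> E") auto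
  next
    fix x assume x: "x \<in> E"
    then have "x \<in> unbounded_sums f" using sub by blast
    then have "x \<in> space M" "\<exists>N. birkhoff_sum T f N x > real 0" unfolding unbounded_sums_def by blast+
    with x show "x \<in> {x \<in> space M. \<exists>N. birkhoff_sum T ?g N x > 0}" by (simp add: g_sum)
  qed
  then have "0 \<le> (\<integral>x. indicator E x * ?g x \<partial>M)"
    using maximal_ergodic[OF g] by simp
  moreover have "indicator E x * ?g x = ?g x" for x by (simp add: indicator_def)
  ultimately show ?thesis by simp
qed

lemma null_set_if_measure_le_0: "B \<in> sets M \<Longrightarrow> measure M B \<le> 0 \<Longrightarrow> B \<in> null_sets M"
  by (simp add: null_sets_def emeasure_eq_measure measure_le_0_iff)

text \<open>The integrals of both functions over the invariant set \<open>?E\<close> are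
  non-negative, but together they give \<open>a - b < 0\<close> times its measure.\<close>

lemma oscillation_null:
  assumes [measurable]: "B \<in> sets M" and "a < b"
  shows "unbounded_sums (\<lambda>x. indicator B x - b) \<inter> unbounded_sums (\<lambda>x. a - indicator B x) \<in> null_sets M"
proof -
  let ?f = "\<lambda>x. indicat_real B x - b" and ?g = "\<lambda>x. a - indicat_real B x"
  let ?E = "unbounded_sums ?f \<inter> unbounded_sums ?g"
  have int: "integrable M ?f" "integrable M ?g"
    by (intro Bochner_Integration.integrable_diff; simp)+
  have inv: "T x \<in> ?E \<longleftrightarrow> x \<in> ?E" if "x \<in> space M" for x
    using unbounded_sums_invariant[OF that] by blast
  have E[measurable]: "?E \<in> sets M" by simp
  have "0 \<le> (\<integral>x. indicator ?E x * ?f x \<partial>M)" "0 \<le> (\<integral>x. indicator ?E x * ?g x \<partial>M)"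
    by (intro integral_invariant_nonneg int E inv; blast)+
  moreover have "integrable M (\<lambda>x. indicator ?E x * ?f x)" "integrable M (\<lambda>x. indicator ?E x * ?g x)"
    using int integrable_real_mult_indicator[OF E] by (simp_all add: mult.commute)
  ultimately have "0 \<le> (\<integral>x. indicator ?E x * ?f x + indicator ?E x * ?g x \<partial>M)"
    by simp
  also have "\<dots> = (\<integral>x. (a - b) * indicator ?E x \<partial>M)"
    by (intro Bochner_Integration.integral_cong) (auto simp: indicator_def)
  also have "\<dots> = (a - b) * measure M ?E" by simp
  finally have "measure M ?E \<le> 0" using \<open>a < b\<close> by (auto simp: zero_le_mult_iff)
  with E show ?thesis by (rule null_set_if_measure_le_0)
qed

text \<open>For every \<open>k\<close>, non-negativity of the integral over the invariant set
  \<open>?E\<close> bounds the measure of \<open>B\<close> inside \<open>?E\<close> by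
  \<open>1 / Suc k\<close>.\<close>

lemma zero_frequency_null:
  assumes [measurable]: "B \<in> sets M"
  shows "B \<inter> (\<Inter>k::nat. unbounded_sums (\<lambda>x. 1 / Suc k - indicator B x)) \<in> null_sets M"
proof -
  let ?g = "\<lambda>k x. 1 / Suc k - indicat_real B x"
  let ?E = "\<Inter>k. unbounded_sums (?g k)"
  have "unbounded_sums (?g k) \<in> sets M" for k by (rule sets_unbounded_sums) measurable
  then have E[measurable]: "?E \<in> sets M" by (intro sets.countable_INT) auto
  have "measure M (B \<inter> ?E) \<le> 1 / Suc k" for k
  proof -
    have "integrable M (?g k)" by (intro Bochner_Integration.integrable_diff) auto
    then have "0 \<le> (\<integral>x. indicator ?E x * ?g k x \<partial>M)"
      by (rule integral_invariant_nonneg) (auto simp: unbounded_sums_invariant)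
    also have "\<dots> = (\<integral>x. 1 / Suc k * indicator ?E x - indicator (B \<inter> ?E) x \<partial>M)"
      by (intro Bochner_Integration.integral_cong) (auto simp: indicator_def)
    also have "\<dots> = 1 / Suc k * measure M ?E - measure M (B \<inter> ?E)"
      by (subst Bochner_Integration.integral_diff) auto
    also have "\<dots> \<le> 1 / Suc k * 1 - measure M (B \<inter> ?E)"
      using prob_le_1[of ?E] by (intro diff_right_mono mult_left_mono) auto
    finally show ?thesis by simp
  qed
  then have "measure M (B \<inter> ?E) \<le> 0"
    by (intro LIMSEQ_le_const[OF LIMSEQ_Suc[OF lim_1_over_n]]) auto
  then show ?thesis by (intro null_set_if_measure_le_0) auto
qed

end

section \<open>Weakly random points\<close>

lemma is_PiE:
  assumes "is_Pi s n A" obtains e where "- A = sigma_set s n e"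
  using assms unfolding is_Pi_def is_Sigma_def by metis

lemma sets_sigma_set: "sigma_set s n e \<in> sets borel"
proof (induction s n e rule: sigma_set.induct)
  case (2 s e)
  have "open (ideal_ball s i)" for i
    unfolding ideal_ball_eq by (intro open_Collect_less continuous_intros)
  then show ?case by auto
next
  case (3 s n e)
  have "(\<Union>i\<in>W e. - sigma_set s (Suc n) i) \<in> sets borel"
    using 3 by (intro sets.countable_UN') (auto simp: borel_comp)
  then show ?case by simp
qed simp

section \<open>Visit counts and oscillation of sequences\<close>

lemma hits_Compl: "hits T (- B) N x = N - hits T B N x"
  and hits_le: "hits T B N x \<le> N"
proof -
  have "{k \<in> {..<N}. (T ^^ k) x \<in> - B} = {..<N} - {k \<in> {..<N}. (T ^^ k) x \<in> B}" by auto
  then show "hits T (- B) N x = N - hits T B N x"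
    unfolding hits_def by (simp only:) (subst card_Diff_subset, auto)
  show "hits T B N x \<le> N"
    unfolding hits_def by (rule order_trans[OF card_mono[of "{..<N}"]]) auto
qed

lemma hits_Un_Int: "hits T B N x + hits T C N x = hits T (B \<union> C) N x + hits T (B \<inter> C) N x"
proof -
  have "{k \<in> {..<N}. (T ^^ k) x \<in> B \<union> C} = {k \<in> {..<N}. (T ^^ k) x \<in> B} \<union> {k \<in> {..<N}. (T ^^ k) x \<in> C}"
    "{k \<in> {..<N}. (T ^^ k) x \<in> B \<inter> C} = {k \<in> {..<N}. (T ^^ k) x \<in> B} \<inter> {k \<in> {..<N}. (T ^^ k) x \<in> C}"
    by auto
  then show ?thesis
    unfolding hits_def using card_Un_Int[of "{k \<in> {..<N}. (T ^^ k) x \<in> B}" "{k \<in> {..<N}. (T ^^ k) x \<in> C}"]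
    by simp
qed

lemma hits_UNIV: "hits T UNIV N x = N"
  unfolding hits_def by simp

lemma birkhoff_sum_indicator: "birkhoff_sum T (indicator B) N x = hits T B N x"
  unfolding birkhoff_sum_def hits_def indicator_def by (simp add: sum.If_cases Int_def)

lemma birkhoff_sum_indicator_diff:
  "birkhoff_sum T (\<lambda>x. indicator B x - c) N x = real (hits T B N x) - c * real N"
  "birkhoff_sum T (\<lambda>x. c - indicator B x) N x = c * real N - real (hits T B N x)"
  using birkhoff_sum_indicator[of T B N x] unfolding birkhoff_sum_def by (simp_all add: sum_subtractf)

text \<open>If the lower limit were below the upper limit, two reals strictly between them would be
  crossed infinitely often.\<close>

lemma convergent_or_oscillates:
  fixes u :: "nat \<Rightarrow> real"
  assumes bounds: "\<And>N. 0 \<le> u N" "\<And>N. u N \<le> 1"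
    and no_osc: "\<And>l h. l < h \<Longrightarrow> \<exists>\<^sub>F N in sequentially. u N < l \<Longrightarrow>
      \<exists>\<^sub>F N in sequentially. h < u N \<Longrightarrow> False"
  shows "\<exists>L. u \<longlonglongrightarrow> L"
proof -
  let ?u = "\<lambda>N. ereal (u N)"
  have le: "limsup ?u \<le> liminf ?u"
  proof (rule ccontr)
    assume "\<not> limsup ?u \<le> liminf ?u"
    then obtain l where l: "liminf ?u < ereal l" "ereal l < limsup ?u"
      by (meson ereal_dense2 not_le)
    then obtain h where h: "ereal l < ereal h" "ereal h < limsup ?u"
      using ereal_dense2 by blast
    have "\<exists>\<^sub>F N in sequentially. u N < l"
    proof (rule ccontr)
      assume "\<not> ?thesis"
      then have "\<forall>\<^sub>F N in sequentially. ereal l \<le> ?u N"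
        by (simp add: not_frequently not_less)
      then have "ereal l \<le> liminf ?u" by (rule Liminf_bounded)
      with l(1) show False by simp
    qed
    moreover have "\<exists>\<^sub>F N in sequentially. h < u N"
    proof (rule ccontr)
      assume "\<not> ?thesis"
      then have "\<forall>\<^sub>F N in sequentially. ?u N \<le> ereal h"
        by (simp add: not_frequently not_less)
      then have "limsup ?u \<le> ereal h" by (rule Limsup_bounded)
      with h(2) show False by simp
    qed
    ultimately show False using no_osc[of l h] h(1) by simp
  qed
  have eq: "liminf ?u = limsup ?u"
    using le Liminf_le_Limsup[of sequentially ?u] by simp
  have "0 \<le> limsup ?u" "limsup ?u \<le> 1"
    using Liminf_bounded[of 0 ?u sequentially] Limsup_bounded[of ?u 1 sequentially] bounds eq by auto
  then obtain L where L: "limsup ?u = ereal L"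
    by (cases "limsup ?u") auto
  have "?u \<longlonglongrightarrow> ereal L"
    using eq L tendsto_iff_Liminf_eq_Limsup[of sequentially ?u "ereal L"] by (simp del: lim_ereal)
  then show ?thesis unfolding lim_ereal by blast
qed

context computable_metric
begin

lemma re_True: "re (\<lambda>z. True)"
  using re_decidable[of "\<lambda>_. True"] computable_const[of 1] by (simp add: decidable_def)

text \<open>Raising the complement of \<open>A\<close> by one level writes it as a c.e. union of
  complements, so \<open>A\<close> is an intersection of sets of the level of \<open>- A\<close>.
  Finite intersections along an enumeration make the sequence decreasing.\<close>

lemma decreasing_neighbourhoods:
  assumes "is_Pi s (Suc n) A"
  obtains V where "uniformly_Sigma UNIV n V" "decseq V" "(\<Inter>i. V i) = A"
proof -
  from assms obtain e where e: "- A = sigma_set s (Suc n) e" by (rule is_PiE)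
  from uniformly_Sigma_Suc[OF uniformly_Sigma_sigma_set[of UNIV n]]
  obtain f where "\<forall>j. \<forall>x\<in>UNIV. x \<in> sigma_set s (Suc n) j \<longleftrightarrow> x \<in> sigma_set s (Suc (Suc n)) (f j)"
    unfolding uniformly_Sigma_iff by blast
  then have f: "sigma_set s (Suc n) e = (\<Union>i\<in>W (f e). base (Suc n) i)"
    unfolding sigma_set_base[of "Suc n"] by blast
  obtain Q where Q: "decidable Q" "\<And>k. k \<in> W (f e) \<longleftrightarrow> (\<exists>t. Q (pair k t))"
    using re_W[OF computable_const computable_id, of "f e"] unfolding re_def by blast
  \<comment> \<open>A number \<open>z\<close> that witnesses no enumeration contributes the whole
    space. This makes the sequence total without changing the intersection.\<close>
  define V0 where "V0 z = (if Q z then sigma_set s (Suc n) (left z) else UNIV)" for z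
  have V0: "uniformly_Sigma UNIV n V0"
    unfolding V0_def[abs_def]
    by (intro uniformly_Sigma_if Q(1) uniformly_Sigma_UNIV uniformly_Sigma_comp[OF uniformly_Sigma_sigma_set] computable_intros)
  have "uniformly_Sigma UNIV n (\<lambda>i. \<Inter>k<i. V0 k)"
    by (intro uniformly_Sigma_INT uniformly_Sigma_comp[OF V0] computable_intros)
  moreover have "decseq (\<lambda>i. \<Inter>k<i. V0 k)"
    by (intro decseq_SucI) auto
  moreover have "(\<Inter>i. \<Inter>k<i. V0 k) = A"
  proof -
    have "x \<in> A \<longleftrightarrow> (\<forall>z. x \<in> V0 z)" for x
    proof -
      have "x \<in> - A \<longleftrightarrow> (\<exists>k\<in>W (f e). x \<notin> sigma_set s (Suc n) k)"
        unfolding e f base.simps by blast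
      also have "\<dots> \<longleftrightarrow> (\<exists>k t. Q (pair k t) \<and> x \<notin> sigma_set s (Suc n) k)"
        unfolding Bex_def Q(2) by blast
      also have "\<dots> \<longleftrightarrow> (\<exists>z. x \<notin> V0 z)"
      proof
        assume "\<exists>z. x \<notin> V0 z"
        then obtain z where "x \<notin> V0 z" by blast
        then have "Q z" "x \<notin> sigma_set s (Suc n) (left z)"
          unfolding V0_def by (simp_all only: split: if_splits) simp_all
        then show "\<exists>k t. Q (pair k t) \<and> x \<notin> sigma_set s (Suc n) k"
          by (intro exI[of _ "left z"] exI[of _ "right z"]) (simp del: sigma_set.simps)
      next
        assume "\<exists>k t. Q (pair k t) \<and> x \<notin> sigma_set s (Suc n) k"
        then obtain k t where "Q (pair k t)" "x \<notin> sigma_set s (Suc n) k" by blast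
        then have "x \<notin> V0 (pair k t)" by (simp add: V0_def del: sigma_set.simps)
        then show "\<exists>z. x \<notin> V0 z" by blast
      qed
      finally show ?thesis by blast
    qed
    moreover have "(\<Inter>i. \<Inter>k<i. V0 k) = (\<Inter>z. V0 z)" by auto
    ultimately show ?thesis by auto
  qed
  ultimately show ?thesis by (rule that)
qed

end

section \<open>Effective dynamics on an invariant set of full measure\<close>

locale computable_mpt = computable_metric s + mpt M T
  for s :: "nat \<Rightarrow> 'a::polish_space" and M :: "'a measure" and T +
  fixes D :: "'a set"
  assumes sets_M: "sets M = sets borel"
    and T_D: "\<And>x. x \<in> D \<Longrightarrow> T x \<in> D"
    and uniformly_Sigma_T: "uniformly_Sigma D 0 (\<lambda>i. T -` ideal_ball s i)"
    and null_D: "- D \<in> null_sets M"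
begin

lemma space_M: "space M = UNIV"
  using sets_eq_imp_space_eq[OF sets_M] by simp

text \<open>\<open>P\<close> is described effectively only inside \<open>D\<close>. The set
  \<open>?P\<close> given by the same index agrees with \<open>P\<close> on \<open>D\<close>, and
  what lies outside is contained in the null set \<open>- D\<close>; so weak randomness applies to
  \<open>?P\<close>.\<close>

lemma weakly_random_avoids:
  assumes "weakly_random s M (Suc (Suc n)) x" "x \<in> D"
    and "uniformly_Sigma D (Suc n) (\<lambda>_. - P)" "P \<subseteq> Z" "Z \<in> null_sets M"
  shows "x \<notin> P"
proof -
  from assms(3) obtain e where e: "\<And>y. y \<in> D \<Longrightarrow> y \<notin> P \<longleftrightarrow> y \<in> sigma_set s (Suc (Suc n)) e"
    unfolding uniformly_Sigma_iff by blast
  let ?P = "- sigma_set s (Suc (Suc n)) e"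
  have "is_Pi s (Suc (Suc n)) ?P" unfolding is_Pi_def is_Sigma_def by auto
  moreover have "?P \<subseteq> Z \<union> - D" using e assms(4) by blast
  then have "?P \<in> null_sets M"
    by (rule null_sets_subset[rotated 2])
      (auto simp: sets_M null_D assms(5) borel_comp sets_sigma_set simp del: sigma_set.simps)
  ultimately have "x \<notin> ?P" using assms(1) unfolding weakly_random_def by blast
  with e assms(2) show ?thesis by blast
qed

lemmas uniformly_Sigma_hits' = uniformly_Sigma_hits[OF T_D uniformly_Sigma_T]

text \<open>For \<open>r > 0\<close> the visit frequency exceeds \<open>p / r\<close> at some time
  from \<open>k\<close> on. Multiplying out avoids division, and \<open>N = 0\<close> never
  satisfies the inequality.\<close>

definition often :: "nat \<Rightarrow> nat \<Rightarrow> 'a set \<Rightarrow> nat \<Rightarrow> 'a set" where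
  "often p r B k = (\<Union>N\<in>{N. k \<le> N}. {x. p * N < r * hits T B N x})"

lemma uniformly_Sigma_often:
  assumes "uniformly_Sigma D n S" "computable p" "computable r" "computable a" "computable k"
  shows "uniformly_Sigma D n (\<lambda>z. often (p z) (r z) (S (a z)) (k z))"
proof -
  note comp = assms(2-)[THEN computable_comp]
  show ?thesis unfolding often_def
    by (intro uniformly_Sigma_UN uniformly_Sigma_hits' assms(1) comp re_decidable decidable_le computable_intros)
qed

lemma mem_often: "x \<in> often p r B k \<longleftrightarrow> (\<exists>N\<ge>k. p * N < r * hits T B N x)"
  unfolding often_def by auto

text \<open>Averages that exceed a threshold by a fixed margin at arbitrarily late times give linear
  growth. This links \<open>often\<close> to the invariant sets of the ergodic estimates.\<close>

lemma mem_unbounded_sums_of_often: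
  assumes "c > 0" "\<And>k. \<exists>N\<ge>k. c * real N \<le> birkhoff_sum T f N x"
  shows "x \<in> unbounded_sums f"
  unfolding unbounded_sums_def space_M
proof (intro CollectI conjI UNIV_I allI)
  fix K :: nat
  obtain k :: nat where k: "real K / c < real k" using reals_Archimedean2 by blast
  obtain N where "N \<ge> k" "c * real N \<le> birkhoff_sum T f N x" using assms(2) by blast
  moreover have "real K < c * real k" using k assms(1) by (simp add: field_simps)
  moreover have "c * real k \<le> c * real N" using \<open>N \<ge> k\<close> assms(1) by simp
  ultimately show "\<exists>N. real K < birkhoff_sum T f N x" by (intro exI[of _ N]) linarith
qed

section \<open>Visit frequencies along a weakly random orbit\<close>

context
  fixes n :: nat and x :: 'a and A :: "'a set"
  assumes random: "weakly_random s M (Suc (Suc n)) x" and x_D: "x \<in> D" and A: "is_Pi s (Suc n) A"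
begin

lemma uniformly_Sigma_Compl_A: "uniformly_Sigma D n (\<lambda>_. - A)"
proof -
  from A obtain e where "- A = sigma_set s (Suc n) e" by (rule is_PiE)
  then show ?thesis
    using uniformly_Sigma_comp[OF uniformly_Sigma_sigma_set[of D n] computable_const[of e]] by simp
qed

lemma sets_A: "A \<in> sets M"
proof -
  from A obtain e where e: "- A = sigma_set s (Suc n) e" by (rule is_PiE)
  have "- sigma_set s (Suc n) e \<in> sets borel" using sets_sigma_set by (rule borel_comp)
  then show ?thesis unfolding e[symmetric] sets_M by simp
qed

text \<open>By the maximal inequality with threshold \<open>1 / r\<close>, the measure of
  \<open>Z i\<close> is at most \<open>r\<close> times that of \<open>?U i\<close>. The sets
  \<open>?U i\<close> decrease to the empty set, so all the \<open>Z i\<close> together meet in a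
  null set.\<close>

lemma eventually_close:
  assumes V: "uniformly_Sigma UNIV n V" "decseq V" "(\<Inter>i. V i) = A" and "r > 0"
  shows "\<exists>i. x \<notin> often 1 r (V i \<inter> - A) 0"
proof -
  let ?U = "\<lambda>i. V i \<inter> - A"
  let ?P = "\<Inter>i. often 1 r (?U i) 0"
  have "uniformly_Sigma D n ?U" by (intro uniformly_Sigma_Int uniformly_Sigma_mono[OF V(1)] uniformly_Sigma_Compl_A)
  then have "uniformly_Sigma D (Suc n) (\<lambda>i. - often 1 r (?U i) 0)"
    by (intro uniformly_Sigma_Compl uniformly_Sigma_often computable_intros)
  then have "uniformly_Sigma D (Suc n) (\<lambda>_. \<Union>i\<in>{i. True}. - often 1 r (?U i) 0)"
    by (intro uniformly_Sigma_Union re_True)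
  then have uniformly_Sigma_P: "uniformly_Sigma D (Suc n) (\<lambda>_. - ?P)" by simp
  from V(1) obtain f where "\<And>i. V i = sigma_set s (Suc n) (f i)"
    unfolding uniformly_Sigma_iff by blast
  then have U[measurable]: "?U i \<in> sets M" for i
    using sets_sigma_set[of s "Suc n"] sets_A sets_M by (metis Diff_eq sets.Diff)
  define Z where "Z i = {y \<in> space M. \<exists>N. birkhoff_sum T (\<lambda>y. indicat_real (?U i) y - 1 / r) N y > 0}" for i
  have Z[measurable]: "Z i \<in> sets M" for i unfolding Z_def by measurable
  have often_Z: "often 1 r (?U i) 0 \<subseteq> Z i" for i
    unfolding Z_def space_M birkhoff_sum_indicator_diff using \<open>r > 0\<close>
    by (fastforce simp: mem_often field_simps simp flip: of_nat_mult)
  have "measure M (Z i) \<le> measure M (?U i) * r" for i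
    using maximal_inequality[OF U, of "1 / r" i] \<open>r > 0\<close> unfolding Z_def by simp
  moreover have "measure M (\<Inter>i. Z i) \<le> measure M (Z i)" for i
    by (intro finite_measure_mono Z) auto
  ultimately have le: "measure M (\<Inter>i. Z i) \<le> measure M (?U i) * r" for i
    by (meson order_trans)
  have "(\<lambda>i. measure M (?U i)) \<longlonglongrightarrow> measure M (\<Inter>i. ?U i)"
    using V(2) by (intro finite_Lim_measure_decseq) (auto simp: decseq_def)
  moreover have "(\<Inter>i. ?U i) = {}" using V(3) by auto
  ultimately have "(\<lambda>i. measure M (?U i)) \<longlonglongrightarrow> 0" by simp
  then have "(\<lambda>i. measure M (?U i) * r) \<longlonglongrightarrow> 0" by (rule tendsto_mult_left_zero)
  then have "measure M (\<Inter>i. Z i) \<le> 0"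
    using le by (intro LIMSEQ_le_const) auto
  then have "(\<Inter>i. Z i) \<in> null_sets M" by (intro null_set_if_measure_le_0) auto
  moreover have "?P \<subseteq> (\<Inter>i. Z i)" using often_Z by blast
  ultimately have "x \<notin> ?P" using weakly_random_avoids[OF random x_D uniformly_Sigma_P] by blast
  then show ?thesis by blast
qed

text \<open>Low averages of \<open>- A\<close> mean many visits to \<open>A\<close>, which
  \<open>often\<close> cannot express at this level; the larger set \<open>V i\<close> replaces
  \<open>A\<close>. As \<open>V i\<close> and \<open>- A\<close> cover the space and overlap with
  frequency at most \<open>1 / r\<close>, a frequency of \<open>V i\<close> above
  \<open>(r - p) / r\<close> forces that of \<open>- A\<close> below
  \<open>(p + 1) / r\<close>.\<close>

lemma no_oscillation:
  assumes V: "uniformly_Sigma UNIV n V" "(\<Inter>i. V i) = A" and "p + 2 \<le> r"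
    and close: "x \<notin> often 1 r (V i \<inter> - A) 0"
    and osc: "\<And>k. x \<in> often (p + 2) r (- A) k" "\<And>k. x \<in> often (r - p) r (V i) k"
  shows False
proof -
  have "r > 0" using assms(3) by simp
  let ?P = "- often 1 r (V i \<inter> - A) 0 \<inter> (\<Inter>k. often (p + 2) r (- A) k) \<inter>
    (\<Inter>k. often (r - p) r (V i) k)"
  have V_i: "uniformly_Sigma D n (\<lambda>_. V i)"
    using uniformly_Sigma_comp[OF uniformly_Sigma_mono[OF V(1)] computable_const] .
  have "uniformly_Sigma D (Suc n) (\<lambda>_. often 1 r (V i \<inter> - A) 0 \<union>
      (\<Union>k\<in>{k. True}. - often (p + 2) r (- A) k) \<union> (\<Union>k\<in>{k. True}. - often (r - p) r (V i) k))"
    using uniformly_Sigma_Suc[OF uniformly_Sigma_often[OF uniformly_Sigma_Int[OF V_i uniformly_Sigma_Compl_A], of "\<lambda>_. 1" "\<lambda>_. r" "\<lambda>_. 0" "\<lambda>_. 0"]]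
      uniformly_Sigma_Compl[OF uniformly_Sigma_often[OF uniformly_Sigma_Compl_A, of "\<lambda>_. p + 2" "\<lambda>_. r" "\<lambda>_. 0" "\<lambda>k. k"]]
      uniformly_Sigma_Compl[OF uniformly_Sigma_often[OF V_i, of "\<lambda>_. r - p" "\<lambda>_. r" "\<lambda>_. 0" "\<lambda>k. k"]]
    by (intro uniformly_Sigma_Un uniformly_Sigma_Union re_True) (simp_all add: computable_const computable_id)
  then have uniformly_Sigma_P: "uniformly_Sigma D (Suc n) (\<lambda>_. - ?P)" by (simp add: Un_assoc)
  text \<open>On \<open>?P\<close> the averages of \<open>- A\<close> are infinitely often above \<open>(p + 2) / r\<close> and infinitely often
    below \<open>(p + 1) / r\<close>; the constants below lie strictly in between.\<close>
  let ?Z = "unbounded_sums (\<lambda>y. indicator (- A) y - (p + 5 / 3) / r) \<inter> unbounded_sums (\<lambda>y. (p + 4 / 3) / r - indicator (- A) y)"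
  have "- A \<in> sets M" using sets_A by (metis Compl_eq_Diff_UNIV sets.compl_sets space_M)
  then have Z: "?Z \<in> null_sets M"
    using \<open>r > 0\<close> by (intro oscillation_null) (auto simp: divide_strict_right_mono)
  have "?P \<subseteq> ?Z"
  proof
    fix y assume y: "y \<in> ?P"
    from y have "y \<notin> often 1 r (V i \<inter> - A) 0" by blast
    then have close: "r * hits T (V i \<inter> - A) N y \<le> N" for N
      by (simp add: mem_often not_less)
    have sum: "hits T (V i) N y + hits T (- A) N y = N + hits T (V i \<inter> - A) N y" for N
    proof -
      have "V i \<union> - A = UNIV" using V(2) by blast
      then show ?thesis using hits_Un_Int[of T "V i" N y "- A"] hits_UNIV[of T N y] by simp
    qed
    \<comment> \<open>This is the distance from \<open>(p + 2) / r\<close> to the upper constant,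
      and from \<open>(p + 1) / r\<close> to the lower one.\<close>
    have pos: "1 / (3 * real r) > 0" using \<open>r > 0\<close> by simp
    have "y \<in> unbounded_sums (\<lambda>y. indicator (- A) y - (p + 5 / 3) / r)"
    proof (rule mem_unbounded_sums_of_often[OF pos])
      fix k
      have "y \<in> often (p + 2) r (- A) k" using y by blast
      then obtain N where N: "N \<ge> k" "(p + 2) * N < r * hits T (- A) N y"
        unfolding mem_often by blast
      from N(2) have "(real p + 2) * N < real r * hits T (- A) N y"
        by (metis (mono_tags, lifting) of_nat_add of_nat_less_iff of_nat_mult of_nat_numeral)
      then have "1 / (3 * real r) * real N \<le> birkhoff_sum T (\<lambda>y. indicator (- A) y - (p + 5 / 3) / r) N y"
        unfolding birkhoff_sum_indicator_diff using \<open>r > 0\<close> by (simp add: field_simps)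
      with N(1) show "\<exists>N\<ge>k. 1 / (3 * real r) * real N \<le> birkhoff_sum T (\<lambda>y. indicator (- A) y - (p + 5 / 3) / r) N y"
        by blast
    qed
    moreover have "y \<in> unbounded_sums (\<lambda>y. (p + 4 / 3) / r - indicator (- A) y)"
    proof (rule mem_unbounded_sums_of_often[OF pos])
      fix k
      have "y \<in> often (r - p) r (V i) k" using y by blast
      then obtain N where N: "N \<ge> k" "(r - p) * N < r * hits T (V i) N y"
        unfolding mem_often by blast
      have "(real r - real p) * N < real r * hits T (V i) N y"
        using N(2) assms(3) by (metis add_leD1 of_nat_diff of_nat_less_iff of_nat_mult)
      moreover have "real r * hits T (V i) N y + real r * hits T (- A) N y \<le> real r * N + N"
      proof -
        have "r * hits T (V i) N y + r * hits T (- A) N y \<le> r * N + N"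
          using sum[of N] close[of N] by (metis add_left_mono distrib_left)
        then show ?thesis by (metis of_nat_add of_nat_le_iff of_nat_mult)
      qed
      ultimately have "real r * hits T (- A) N y \<le> (real p + 1) * real N" by (simp add: algebra_simps)
      then have "1 / (3 * real r) * real N \<le> birkhoff_sum T (\<lambda>y. (p + 4 / 3) / r - indicator (- A) y) N y"
        unfolding birkhoff_sum_indicator_diff using \<open>r > 0\<close> by (simp add: field_simps)
      with N(1) show "\<exists>N\<ge>k. 1 / (3 * real r) * real N \<le> birkhoff_sum T (\<lambda>y. (p + 4 / 3) / r - indicator (- A) y) N y"
        by blast
    qed
    ultimately show "y \<in> ?Z" by blast
  qed
  from weakly_random_avoids[OF random x_D uniformly_Sigma_P this Z] close osc show False by blast
qed

text \<open>Otherwise the frequencies of \<open>A\<close> at \<open>x\<close> have lower limit 0.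
  Expressed through late high frequencies of \<open>- A\<close>, this is a condition of the level
  avoided by \<open>x\<close>, and it defines a subset of the null set of
  \<open>zero_frequency_null\<close>.\<close>

lemma positive_frequency:
  assumes "x \<in> A"
  shows "\<exists>k m. x \<notin> often k (Suc k) (- A) m"
proof (rule ccontr)
  assume contra: "\<not> ?thesis"
  let ?P = "A \<inter> (\<Inter>z. often (left z) (Suc (left z)) (- A) (right z))"
  have "uniformly_Sigma D (Suc n) (\<lambda>_. - A \<union> (\<Union>z\<in>{z. True}. - often (left z) (Suc (left z)) (- A) (right z)))"
    using uniformly_Sigma_Compl[OF uniformly_Sigma_often[OF uniformly_Sigma_Compl_A, of left "\<lambda>z. Suc (left z)" "\<lambda>_. 0" right]]
    by (intro uniformly_Sigma_Un uniformly_Sigma_Suc[OF uniformly_Sigma_Compl_A] uniformly_Sigma_Union re_True) (simp_all add: computable_basic)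
  then have uniformly_Sigma_P: "uniformly_Sigma D (Suc n) (\<lambda>_. - ?P)" by simp
  let ?Z = "A \<inter> (\<Inter>k::nat. unbounded_sums (\<lambda>y. 1 / Suc k - indicator A y))"
  have Z: "?Z \<in> null_sets M" by (rule zero_frequency_null[OF sets_A])
  have "?P \<subseteq> ?Z"
  proof
    fix y assume y: "y \<in> ?P"
    have "y \<in> unbounded_sums (\<lambda>y. 1 / Suc k - indicator A y)" for k
    proof (rule mem_unbounded_sums_of_often)
      show "1 / (2 * real (Suc k)) > 0" by simp
      fix m
      \<comment> \<open>A frequency of \<open>- A\<close> above
        \<open>(2 * k + 1) / (2 * k + 2)\<close> keeps that of \<open>A\<close> below half of
        \<open>1 / Suc k\<close>; the other half is the rate of linear growth.\<close>
      have "y \<in> often (2 * k + 1) (Suc (2 * k + 1)) (- A) m"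
        using y by (metis (no_types, lifting) IntE INT_E UNIV_I fst_conv prod_encode_inverse snd_conv)
      then obtain N where N: "N \<ge> m" "(2 * k + 1) * N < Suc (2 * k + 1) * hits T (- A) N y"
        unfolding mem_often by blast
      have compl: "real (hits T (- A) N y) = real N - real (hits T A N y)"
        unfolding hits_Compl using hits_le[of T A N y] by (rule of_nat_diff)
      have "(2 * real k + 1) * N < (2 * real k + 2) * hits T (- A) N y"
      proof -
        have "real ((2 * k + 1) * N) < real (Suc (2 * k + 1) * hits T (- A) N y)"
          using N(2) by (simp only: of_nat_less_iff)
        then show ?thesis by (simp add: algebra_simps)
      qed
      then have "(2 * real k + 2) * hits T A N y \<le> N" unfolding compl by (simp add: algebra_simps)
      moreover define q where "q = real N / (2 * real (Suc k))"
      ultimately have "real (hits T A N y) \<le> q" by (simp add: le_divide_eq algebra_simps)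
      moreover have q: "1 / (2 * real (Suc k)) * real N = q" "1 / real (Suc k) * real N = 2 * q"
        by (simp_all add: q_def field_simps)
      ultimately have "1 / (2 * real (Suc k)) * real N \<le> birkhoff_sum T (\<lambda>y. 1 / Suc k - indicator A y) N y"
        unfolding birkhoff_sum_indicator_diff q by linarith
      with N(1) show "\<exists>N\<ge>m. 1 / (2 * real (Suc k)) * real N \<le> birkhoff_sum T (\<lambda>y. 1 / Suc k - indicator A y) N y"
        by blast
    qed
    with y show "y \<in> ?Z" by blast
  qed
  from weakly_random_avoids[OF random x_D uniformly_Sigma_P this Z] contra assms show False by blast
qed

lemma frequency_Compl_converges:
  "\<exists>L. (\<lambda>N. hits T (- A) N x / N) \<longlonglongrightarrow> L"
proof (rule convergent_or_oscillates)
  let ?u = "\<lambda>N. real (hits T (- A) N x) / N"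
  show bounds: "0 \<le> ?u N" "?u N \<le> 1" for N
    using hits_le[of T "- A" N x] by (auto simp: divide_le_eq_1)
  fix l h :: real assume "l < h" and low: "\<exists>\<^sub>F N in sequentially. ?u N < l"
    and high: "\<exists>\<^sub>F N in sequentially. h < ?u N"
  obtain V where V: "uniformly_Sigma UNIV n V" "decseq V" "(\<Inter>i. V i) = A"
    using decreasing_neighbourhoods[OF A] .
  have "l > 0" using frequently_ex[OF low] bounds(1) by (meson le_less_trans)
  have "h < 1" using frequently_ex[OF high] bounds(2) by (meson less_le_trans)
  \<comment> \<open>The interval from \<open>l * r\<close> to \<open>h * r\<close> is longer than 3,
    so it contains both \<open>p\<close> and \<open>p + 2\<close> when \<open>l * r\<close> is
    rounded up to \<open>p\<close>.\<close>
  obtain r :: nat where r: "3 / (h - l) < r" using reals_Archimedean2 by blast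
  have "r > 0" using r \<open>l < h\<close> by (metis diff_gt_0_iff_gt divide_pos_pos less_trans of_nat_0_less_iff zero_less_numeral)
  define p where "p = nat \<lceil>l * r\<rceil>"
  have p: "l * r \<le> p" "p < l * r + 1"
    using \<open>l > 0\<close> ceiling_correct[of "l * r"] unfolding p_def by (auto simp: of_nat_nat)
  have p2: "p + 2 < h * r" using p(2) r \<open>l < h\<close> by (simp add: field_simps)
  moreover have "h * r \<le> r" using \<open>h < 1\<close> mult_right_mono[of h 1 "real r"] by simp
  ultimately have "p + 2 \<le> r" by linarith
  obtain i where i: "x \<notin> often 1 r (V i \<inter> - A) 0"
    using eventually_close[OF V \<open>r > 0\<close>] by blast
  show False
  proof (rule no_oscillation[OF V(1,3) \<open>p + 2 \<le> r\<close> i])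
    fix k
    \<comment> \<open>The bound 1 excludes \<open>N = 0\<close>, where the quotient is 0 by
      convention.\<close>
    have ev: "\<forall>\<^sub>F N in sequentially. N \<ge> max k 1" by (rule eventually_ge_at_top)
    show "x \<in> often (p + 2) r (- A) k"
    proof -
      from frequently_ex[OF frequently_eventually_frequently[OF high ev]]
      obtain N where N: "h < ?u N" "N \<ge> k" "N > 0" by auto
      have "(real p + 2) * N \<le> r * (h * N)"
        using p2 mult_right_mono[of "real p + 2" "h * r" "real N"] by (simp add: mult_ac)
      also have "\<dots> < r * real (hits T (- A) N x)"
        using N \<open>r > 0\<close> by (simp add: less_divide_eq)
      finally have "real ((p + 2) * N) < real (r * hits T (- A) N x)" by (simp add: algebra_simps)
      then show ?thesis using N(2) unfolding mem_often of_nat_less_iff by blast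
    qed
    show "x \<in> often (r - p) r (V i) k"
    proof -
      from frequently_ex[OF frequently_eventually_frequently[OF low ev]]
      obtain N where N: "?u N < l" "N \<ge> k" "N > 0" by auto
      have "r * real (hits T (- A) N x) < r * (l * N)"
        using N \<open>r > 0\<close> by (simp add: divide_less_eq)
      also have "\<dots> \<le> real p * N"
        using p(1) mult_right_mono[of "l * r" "real p" "real N"] by (simp add: mult_ac)
      finally have less: "r * hits T (- A) N x < p * N"
        by (metis of_nat_less_iff of_nat_mult)
      \<comment> \<open>Every time that is not a visit to \<open>- A\<close> is a visit to
        \<open>V i\<close>, so few visits to \<open>- A\<close> yield many to
        \<open>V i\<close>.\<close>
      have "V i \<union> - A = UNIV" using V(3) by blast
      then have "N \<le> hits T (V i) N x + hits T (- A) N x"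
        using hits_Un_Int[of T "V i" N x "- A"] hits_UNIV[of T N x] by simp
      then have "r * N \<le> r * hits T (V i) N x + r * hits T (- A) N x"
        by (metis distrib_left mult_le_mono2)
      moreover have "p * N \<le> r * N" using \<open>p + 2 \<le> r\<close> by (intro mult_le_mono1) simp
      ultimately have "(r - p) * N < r * hits T (V i) N x"
        using less unfolding diff_mult_distrib by linarith
      then show ?thesis using N(2) unfolding mem_often by blast
    qed
  qed
qed

text \<open>The frequencies of \<open>A\<close> converge to \<open>1 - l\<close>. If
  \<open>l\<close> were 1, those of \<open>- A\<close> would eventually exceed every
  \<open>k / Suc k\<close>, against \<open>positive_frequency\<close>.\<close>

lemma frequency_converges_positive:
  assumes "x \<in> A"
  shows "\<exists>L>0. (\<lambda>N. hits T A N x / N) \<longlonglongrightarrow> L"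
proof -
  let ?u = "\<lambda>N. real (hits T (- A) N x) / N"
  obtain l where l: "?u \<longlonglongrightarrow> l" using frequency_Compl_converges by blast
  have "l \<le> 1"
    using hits_le[of T "- A" _ x] by (intro LIMSEQ_le_const2[OF l]) (auto simp: divide_le_eq_1)
  moreover have "l \<noteq> 1"
  proof
    assume "l = 1"
    have "x \<in> often k (Suc k) (- A) m" for k m
    proof -
      have "\<forall>\<^sub>F N in sequentially. real k / Suc k < ?u N"
        using l \<open>l = 1\<close> by (intro order_tendstoD(1)) auto
      then have "\<forall>\<^sub>F N in sequentially. real k / Suc k < ?u N \<and> N \<ge> max m 1"
        using eventually_ge_at_top by (rule eventually_conj)
      then obtain N where N: "real k / Suc k < ?u N" "N \<ge> m" "N > 0"
        unfolding eventually_sequentially by (metis max.bounded_iff order_refl less_eq_Suc_le One_nat_def)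
      then have "real (k * N) < real (Suc k * hits T (- A) N x)"
        unfolding of_nat_mult by (subst (asm) divide_less_divide_iff) (simp_all add: mult.commute)
      then show ?thesis using N(2) unfolding mem_often of_nat_less_iff by blast
    qed
    then show False using positive_frequency[OF assms] by blast
  qed
  moreover have "(\<lambda>N. hits T A N x / N) \<longlonglongrightarrow> 1 - l"
  proof (rule Lim_transform_eventually)
    show "(\<lambda>N. 1 - ?u N) \<longlonglongrightarrow> 1 - l" by (intro tendsto_diff tendsto_const l)
    show "\<forall>\<^sub>F N in sequentially. 1 - ?u N = hits T A N x / N"
      \<comment> \<open>At \<open>N = 0\<close> both quotients are 0 and the identity fails.\<close>
      using eventually_gt_at_top[of 0]
    proof eventually_elim
      case (elim N)
      then show ?case using hits_le[of T A N x] by (simp add: hits_Compl of_nat_diff field_simps)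
    qed
  qed
  ultimately show ?thesis by (intro exI[of _ "1 - l"]) simp
qed

end

end

section \<open>Passage from the partial map to a total one\<close>

theorem theorem4p25:
  fixes s :: "nat \<Rightarrow> 'a::polish_space" and M :: "'a measure" and n :: nat
    and x :: 'a and A :: "'a set" and T :: "'a \<rightharpoonup> 'a"
  assumes "computable_prob_space s M"
    and "n \<ge> 1"
    and "weakly_random s M (n + 1) x"
    and "is_Pi s n A" and "x \<in> A" and "measure M A > 0"
    and "measure_preserving M T" and "computable_map s T" and "x \<in> dom T"
  shows "\<exists>L>0. (\<lambda>N. 1 / real N * (\<Sum>k<N. indicat_real A (((\<lambda>y. the (T y)) ^^ k) x)))
           \<longlonglongrightarrow> L"
proof -
  let ?D = "dom T"
  \<comment> \<open>\<open>T\<close> is made total by the identity outside its domain. Since the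
    complement of the domain is null, preimages change only by null sets and the measure is still
    preserved.\<close>
  define S where "S y = (if y \<in> ?D then the (T y) else y)" for y
  from assms(1) have metric: "computable_metric_space s" and "prob_space M" and sets_M: "sets M = sets borel"
    unfolding computable_prob_space_def by auto
  interpret prob_space M by fact
  have space_M: "space M = UNIV" using sets_eq_imp_space_eq[OF sets_M] by simp
  from assms(7) have pre: "\<And>B. B \<in> sets borel \<Longrightarrow> T -` (Some ` B) \<in> sets borel"
      "\<And>B. B \<in> sets borel \<Longrightarrow> emeasure M (T -` (Some ` B)) = emeasure M B"
      "\<And>y. y \<in> ?D \<Longrightarrow> the (T y) \<in> ?D"
    unfolding measure_preserving_def by auto
  have D: "T -` (Some ` UNIV) = ?D" by (auto simp: image_iff)
  have sets_D: "?D \<in> sets M" and "emeasure M ?D = emeasure M (space M)"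
    using pre(1,2)[of UNIV] unfolding D sets_M space_M by auto
  then have null_D: "- ?D \<in> null_sets M"
    using emeasure_compl[of ?D M] by (auto intro!: null_setsI simp: space_M Compl_eq_Diff_UNIV sets_M borel_comp)
  have S_vimage: "S -` B = T -` (Some ` B) \<union> (B - ?D)" for B
    by (auto simp: S_def image_iff dom_def split: if_splits)
  have S_meas: "S \<in> measurable M M"
  proof (rule measurableI)
    show "S -` B \<inter> space M \<in> sets M" if "B \<in> sets M" for B
      using that pre(1)[of B] sets_D unfolding S_vimage space_M sets_M by auto
  qed (simp add: space_M)
  have "distr M M S = M"
  proof (rule measure_eqI)
    fix B assume "B \<in> sets (distr M M S)"
    then have B: "B \<in> sets M" by simp
    have "emeasure M (S -` B) = emeasure M (T -` (Some ` B))"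
      unfolding S_vimage
    proof (rule emeasure_Un_null_set)
      show "T -` (Some ` B) \<in> sets M" using pre(1) B sets_M by simp
      show "B - ?D \<in> null_sets M"
        by (rule null_sets_subset[OF null_D]) (use B sets_D in auto)
    qed
    then show "emeasure (distr M M S) B = emeasure M B"
      using pre(2)[of B] B sets_M by (simp add: emeasure_distr[OF S_meas B] space_M)
  qed simp
  interpret computable_metric s by unfold_locales (rule metric)
  interpret computable_mpt s M S ?D
  proof unfold_locales
    show "uniformly_Sigma ?D 0 (\<lambda>i. S -` ideal_ball s i)"
    proof -
      from assms(8) obtain f where f: "computable f"
          "\<And>i. T -` (Some ` ideal_ball s i) = ?D \<inter> sigma_set s 1 (f i)"
        unfolding computable_map_def uniformly_def Sigma_in_index_def by blast
      have "y \<in> S -` ideal_ball s i \<longleftrightarrow> y \<in> sigma_set s (Suc 0) (f i)" if "y \<in> ?D" for y i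
        using f(2)[of i] that unfolding S_vimage by auto
      then show ?thesis unfolding uniformly_Sigma_iff using f(1) by blast
    qed
  qed (use S_meas sets_M null_D pre(3) \<open>distr M M S = M\<close> in \<open>auto simp: S_def\<close>)
  obtain m where n: "n = Suc m" using assms(2) by (cases n) auto
  \<comment> \<open>The orbit of \<open>x\<close> never leaves the domain, so \<open>S\<close> and
    \<open>T\<close> produce the same orbit.\<close>
  have "(S ^^ k) x = ((\<lambda>y. the (T y)) ^^ k) x \<and> (S ^^ k) x \<in> ?D" for k
    by (induction k) (use assms(9) pre(3) in \<open>auto simp: S_def\<close>)
  then have eq: "1 / real N * (\<Sum>k<N. indicat_real A (((\<lambda>y. the (T y)) ^^ k) x)) = hits S A N x / N" for N
    using birkhoff_sum_indicator[of S A N x] unfolding birkhoff_sum_def by simp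
  have "weakly_random s M (Suc (Suc m)) x" "is_Pi s (Suc m) A"
    using assms(3,4) unfolding n by simp_all
  from frequency_converges_positive[OF this(1) assms(9) this(2) assms(5)]
  show ?thesis unfolding eq .
qed

end
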